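(* Let $e=2e'+1\ge3$ be an odd integer, let $\mathbf a=(a_1,\ldots,a_e)$ be positive integers with $\mathbf a\ne(1,1,1)$, and let $\mathbb M=(m_{ij})_{1\le i,j\le e}$ be the matrix $$m_{ij}=\begin{cases}-1&\text{if } i=j,\\ 0&\text{if } i<j\le i+e',\\ a_j&\text{otherwise,}\end{cases}$$ where indices are read cyclically modulo $e$ (so the second case is $0<(j-i\bmod e)\le e'$). Consider the column vector $$(n_1,\ldots,n_e)^{\intercal}=\det(\mathbb M)\cdot\mathbb M^{-1}\mathbf 1_e,$$ where $\mathbf 1_e$ is the column vector of length $e$ with all entries $1$. Then (1) $\det(\mathbb M)>0$; (2) $n_i>0$ for every $i=1,\ldots,e$. Moreover, if $\gcd(n_1,\ldots,n_e)=1$, then (3) $H=\langle n_1,\ldots,n_e\rangle$ has embedding dimension $e$; (4) $H$ is pseudo-symmetric with $\mathrm{PF}(H)=\{\det(\mathbb M),2\det(\mathbb M)\}$; (5) $I_H$ is critical; in particular, it is an almost complete intersection; (6) the exponents $\alpha_i$ of the critical binomials satisfy $\alpha_i=a_i+1$ for $i=1,\ldots,e$; (7) $\mathbb M$ is an RF-matrix for the pseudo-Frobenius number $\det(\mathbb M)$.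
   Context: A numerical semigroup is an additive submonoid $H$ of $\mathbb N=\{0,1,2,\dots\}$ with finite complement; $\langle n_1,\dots,n_e\rangle$ (the submonoid generated by the $n_i$) is one iff $\gcd(n_1,\dots,n_e)=1$. The embedding dimension is the cardinality of the unique minimal generating set. $\mathrm{Fr}(H)=\max(\mathbb Z\setminus H)$; $\mathrm{PF}(H)$ is the set of $f\in\mathbb Z\setminus H$ with $f+n_i\in H$ for all $i$. $H$ is pseudo-symmetric if $\mathrm{Fr}(H)$ is even and $\mathrm{PF}(H)=\{\mathrm{Fr}(H),\mathrm{Fr}(H)/2\}$. For a field $\Bbbk$, $I_H$ is the kernel of $\Bbbk[x_1,\dots,x_e]\to\Bbbk[t]$, $x_i\mapsto t^{n_i}$. $I_H$ is an almost complete intersection if it is minimally generated by $e$ elements. Set $\alpha_i=\min\{a\in\mathbb Z_{>0}: an_i\in\langle n_1,\dots,n_{i-1},n_{i+1},\dots,n_e\rangle\}$. A critical binomial with respect to $x_i$ is a binomial in $I_H$ of the form $x_i^{\alpha_i}-\prod_{j\ne i}x_j^{b_j}$. $I_H$ is critical if it is generated by critical binomials, one for each variable $x_1,\dots,x_e$. For $f\in\mathrm{PF}(H)$, an RF-matrix of $f$ is an integer $e\times e$ matrix $(m_{ij})$ with $m_{ii}=-1$, $m_{ij}\ge0$ for $i\ne j$, and $\sum_j m_{ij}n_j=f$ for all $i$. *)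

theory Defs
  imports
    "HOL-Library.Poly_Mapping"
    "HOL-Computational_Algebra.Polynomial"
    "HOL-Algebra.Ideal"
    "Jordan_Normal_Form.Gauss_Jordan_Elimination"
    "Jordan_Normal_Form.Determinant"
begin

text \<open>Throughout, the indices \<open>1, \<dots>, e\<close> of the mathematical text are \<open>0, \<dots>, e - 1\<close>, and
  families indexed by them are functions on \<open>nat\<close> of which only the values below \<open>e\<close> matter.\<close>

section \<open>Numerical semigroups\<close>

definition add_submonoid :: "nat set \<Rightarrow> bool" where
  "add_submonoid S \<longleftrightarrow> 0 \<in> S \<and> (\<forall>x\<in>S. \<forall>y\<in>S. x + y \<in> S)"

definition submonoid_gen :: "nat set \<Rightarrow> nat set" where
  "submonoid_gen A = add_submonoid hull A"

definition numerical_semigroup :: "nat set \<Rightarrow> bool" where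
  "numerical_semigroup H \<longleftrightarrow> add_submonoid H \<and> finite (- H)"

definition minimal_generating_set :: "nat set \<Rightarrow> nat set \<Rightarrow> bool" where
  "minimal_generating_set H A \<longleftrightarrow>
     submonoid_gen A = H \<and> (\<forall>B. B \<subset> A \<longrightarrow> submonoid_gen B \<noteq> H)"

definition min_gens :: "nat set \<Rightarrow> nat set" where
  "min_gens H = (THE A. minimal_generating_set H A)"

definition embedding_dimension :: "nat set \<Rightarrow> nat" where
  "embedding_dimension H = card (min_gens H)"

text \<open>The complement of \<open>H\<close> is taken in the integers, so that all negative integers are gaps.\<close>

definition frobenius_number :: "nat set \<Rightarrow> int" where
  "frobenius_number H = (GREATEST f. f \<notin> int ` H)"

definition pseudo_frobenius :: "nat set \<Rightarrow> int set" where
  "pseudo_frobenius H = {f. f \<notin> int ` H \<and> (\<forall>n\<in>min_gens H. f + int n \<in> int ` H)}"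

definition pseudo_symmetric :: "nat set \<Rightarrow> bool" where
  "pseudo_symmetric H \<longleftrightarrow> numerical_semigroup H \<and> even (frobenius_number H) \<and>
     pseudo_frobenius H = {frobenius_number H, frobenius_number H div 2}"

definition crit_exp :: "nat \<Rightarrow> (nat \<Rightarrow> nat) \<Rightarrow> nat \<Rightarrow> nat" where
  "crit_exp e n i = (LEAST a. a > 0 \<and> a * n i \<in> submonoid_gen (n ` ({..<e} - {i})))"


section \<open>The polynomial ring and the defining ideal\<close>

text \<open>An element of \<open>(nat \<Rightarrow>\<^sub>0 nat) \<Rightarrow>\<^sub>0 'k\<close> is a polynomial in countably many variables: it maps
  exponent vectors to coefficients, and the library multiplication is convolution.  The ring
  \<open>k[x\<^sub>0, \<dots>, x\<^bsub>e-1\<^esub>]\<close> is the subring of those in which only variables below \<open>e\<close> occur.\<close>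

type_synonym 'k mpoly = "(nat \<Rightarrow>\<^sub>0 nat) \<Rightarrow>\<^sub>0 'k"

definition mpoly_ring :: "nat \<Rightarrow> ('k::field) mpoly ring" where
  "mpoly_ring e =
     \<lparr>carrier = {p. \<forall>m\<in>Poly_Mapping.keys p. Poly_Mapping.keys m \<subseteq> {..<e}},
      monoid.mult = (*), one = 1, zero = 0, add = (+)\<rparr>"

definition mvar :: "nat \<Rightarrow> ('k::field) mpoly" where
  "mvar i = Poly_Mapping.single (Poly_Mapping.single i 1) 1"

text \<open>The \<open>k\<close>-algebra homomorphism to \<open>k[t]\<close> with \<open>x\<^sub>i \<mapsto> t ^ n\<^sub>i\<close>.\<close>

definition toric_map :: "(nat \<Rightarrow> nat) \<Rightarrow> ('k::field) mpoly \<Rightarrow> 'k poly" where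
  "toric_map n p =
     (\<Sum>m\<in>Poly_Mapping.keys p. Polynomial.smult (Poly_Mapping.lookup p m)
        (\<Prod>i\<in>Poly_Mapping.keys m. Polynomial.monom 1 (n i) ^ Poly_Mapping.lookup m i))"

definition toric_ideal :: "nat \<Rightarrow> (nat \<Rightarrow> nat) \<Rightarrow> ('k::field) mpoly set" where
  "toric_ideal e n = {p \<in> carrier (mpoly_ring e). toric_map n p = 0}"

definition critical_binomial ::
  "nat \<Rightarrow> (nat \<Rightarrow> nat) \<Rightarrow> nat \<Rightarrow> ('k::field) mpoly \<Rightarrow> bool" where
  "critical_binomial e n i f \<longleftrightarrow> f \<in> toric_ideal e n \<and>
     (\<exists>b :: nat \<Rightarrow> nat. f = mvar i ^ crit_exp e n i - (\<Prod>j\<in>{..<e} - {i}. mvar j ^ b j))"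

definition toric_ideal_critical :: "('k::field) itself \<Rightarrow> nat \<Rightarrow> (nat \<Rightarrow> nat) \<Rightarrow> bool" where
  "toric_ideal_critical _ e n \<longleftrightarrow>
     (\<exists>f :: nat \<Rightarrow> 'k mpoly. (\<forall>i<e. critical_binomial e n i (f i)) \<and>
        toric_ideal e n = Idl\<^bsub>mpoly_ring e\<^esub> (f ` {..<e}))"

text \<open>\<open>r\<close> is the least cardinality of a generating set; this is stronger than the existence of an
  irredundant generating set of size \<open>r\<close>.\<close>

definition minimally_generated_by :: "('a, 'b) ring_scheme \<Rightarrow> 'a set \<Rightarrow> nat \<Rightarrow> bool" where
  "minimally_generated_by R I r \<longleftrightarrow>
     (\<exists>G. G \<subseteq> carrier R \<and> finite G \<and> card G = r \<and> Idl\<^bsub>R\<^esub> G = I) \<and>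
     (\<forall>G. G \<subseteq> carrier R \<and> finite G \<and> Idl\<^bsub>R\<^esub> G = I \<longrightarrow> r \<le> card G)"

definition toric_ideal_almost_ci :: "('k::field) itself \<Rightarrow> nat \<Rightarrow> (nat \<Rightarrow> nat) \<Rightarrow> bool" where
  "toric_ideal_almost_ci _ e n \<longleftrightarrow>
     minimally_generated_by (mpoly_ring e) (toric_ideal e n :: 'k mpoly set) e"


section \<open>RF-matrices\<close>

definition rf_matrix :: "nat \<Rightarrow> (nat \<Rightarrow> nat) \<Rightarrow> int \<Rightarrow> int mat \<Rightarrow> bool" where
  "rf_matrix e n f M \<longleftrightarrow>
     f \<in> pseudo_frobenius (submonoid_gen (n ` {..<e})) \<and>
     M \<in> carrier_mat e e \<and>
     (\<forall>i<e. M $$ (i, i) = -1) \<and>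
     (\<forall>i<e. \<forall>j<e. i \<noteq> j \<longrightarrow> M $$ (i, j) \<ge> 0) \<and>
     (\<forall>i<e. (\<Sum>j<e. M $$ (i, j) * int (n j)) = f)"

definition cyc_mat :: "nat \<Rightarrow> nat list \<Rightarrow> int mat" where
  "cyc_mat e' a = (let e = 2 * e' + 1 in
     mat e e (\<lambda>(i, j).
       if i = j then -1
       else if 0 < (int j - int i) mod int e \<and> (int j - int i) mod int e \<le> int e' then 0
       else int (a ! j)))"

text \<open>The vector \<open>det M \<cdot> M\<inverse> 1\<close>, with the inverse formed over the rationals;
  it is meaningful only for invertible \<open>M\<close>.\<close>

definition det_inv_one :: "int mat \<Rightarrow> rat vec" where
  "det_inv_one M = rat_of_int (Determinant.det M) \<cdot>\<^sub>v
     (the (mat_inverse (map_mat rat_of_int M)) *\<^sub>v vec (dim_row M) (\<lambda>_. 1))"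

end

theory Submission
  imports Defs "HOL-Library.FuncSet" "HOL-Computational_Algebra.Group_Closure" "HOL-Number_Theory.Cong"
begin

text \<open>Doubling is invertible on \<open>\<int>/e\<close>, and reindexing by its inverse turns \<open>M n = det M \<cdot> 1\<close> into the cyclic system
  \<open>(b\<^sub>k + 1) v\<^sub>k + v\<^bsub>k+1\<^esub> = C\<close> with \<open>C = \<Prod>(b\<^sub>k + 1) + 1\<close>.  Subtracting consecutive equations gives the critical
  binomials \<open>y\<^sub>k ^ (b\<^sub>k + 1) - y\<^bsub>k+1\<^esub> ^ b\<^bsub>k+1\<^esub> y\<^bsub>k+2\<^esub>\<close>.  Rewriting with them reduces every monomial to a power of \<open>y\<^sub>0\<close>
  times one of at most \<open>v\<^sub>0\<close> explicit normal forms.  If the \<open>v\<^sub>k\<close> are coprime, the degrees of the normal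
  forms meet all residue classes modulo \<open>v\<^sub>0\<close>, so they are pairwise incongruent.  Hence two monomials of the
  same degree are connected by critical binomials, which therefore generate the ideal, and the degrees of
  the normal forms are the Apery set of \<open>H\<close> with respect to \<open>v\<^sub>0\<close>, from which the pseudo-Frobenius numbers
  are read off.  No side of a critical binomial divides \<open>y\<^sub>k ^ x\<close> for \<open>x \<le> b\<^sub>k\<close>; this isolation gives the
  embedding dimension, the critical exponents and the minimal number of generators.\<close>

section \<open>Rewriting monomials by cyclic binomials\<close>

text \<open>Two points decide the shape of the proof. Uniqueness of normal forms is never proved by
  checking confluence; it comes from counting. The cyclic system has an alternating sum of products
  as its solution, and pairing consecutive terms turns this sum into
  \<open>1 + (\<Sum>j<e'. b (2 * j + 1) * ...)\<close>, whose summands are the sizes of explicit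
  boxes of exponent vectors. This is why the normal forms are organised in blocks indexed by the odd
  positions. The determinant comes from adding cyclically adjacent rows of the reindexed matrix: the
  result is the row \<open>b\<close> minus a row of the cyclic system. Hence the matrix is, up to
  sign and a factor of determinant 2 (here \<open>e\<close> must be odd), a rank-one perturbation of
  the coefficient matrix \<open>N\<close> of that system. This yields 2 d = (sum of the b_k v_k) -
  C, from which the degrees d + v_0 and 2 d + v_0 of the decisive normal forms are computed. For e =
  3 and all b_k = 1 one gets C = 9, v_k = 3 and d = 0, which explains the excluded vector.\<close>

definition pt :: "nat \<Rightarrow> nat \<Rightarrow> nat \<Rightarrow> nat" where
  "pt k x = (\<lambda>i. if i = k then x else 0)"

definition madd :: "(nat \<Rightarrow> nat) \<Rightarrow> (nat \<Rightarrow> nat) \<Rightarrow> nat \<Rightarrow> nat"  (infixl "\<boxplus>" 65) where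
  "m \<boxplus> m' = (\<lambda>i. m i + m' i)"

lemma madd_apply: "(m \<boxplus> m') i = m i + m' i"
  by (simp add: madd_def)

lemma madd_ac: "m \<boxplus> m' = m' \<boxplus> m" "m \<boxplus> m' \<boxplus> m'' = m \<boxplus> (m' \<boxplus> m'')" "m \<boxplus> (m' \<boxplus> m'') = m' \<boxplus> (m \<boxplus> m'')"
  by (simp_all add: madd_def fun_eq_iff)

lemma pt_add: "pt k (x + y) = pt k x \<boxplus> pt k y"
  by (auto simp: pt_def madd_apply fun_eq_iff)

text \<open>\<open>rel\<close> and \<open>d_eq\<close> survive a common scaling of \<open>v\<close>,
  \<open>C\<close> and \<open>d\<close>. The assumption \<open>v0_eq\<close> fixes the scale, in the
  shape in which normal forms are counted. In the application \<open>d\<close> is the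
  determinant.\<close>

locale cyclic_relations =
  fixes e' e :: nat and b v :: "nat \<Rightarrow> nat" and C d :: nat
  assumes e_eq: "e = 2 * e' + 1" and e'_pos: "e' > 0"
    and b_pos: "\<And>k. b k > 0" and v_pos: "\<And>k. v k > 0"
    and b_per: "\<And>k. b (k + e) = b k" and v_per: "\<And>k. v (k + e) = v k"
    and rel: "\<And>k. (b k + 1) * v k + v (k + 1) = C"
    and v0_eq: "v 0 = 1 + (\<Sum>j<e'. b (2 * j + 1) * (\<Prod>k\<in>{2 * j + 2..<e}. b k + 1))"
    and d_eq: "d + (\<Sum>k<e. v k) = e' * C" and d_pos: "d > 0"
begin

lemma e_ge3: "e \<ge> 3"
  using e_eq e'_pos by simp

lemma per_mod: "b (k mod e) = b k" "v (k mod e) = v k"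
proof -
  have *: "b (i + j * e) = b i \<and> v (i + j * e) = v i" for i j
    by (induction j) (use b_per[of "i + _ * e"] v_per[of "i + _ * e"] in \<open>auto simp: algebra_simps\<close>)
  from *[of "k mod e" "k div e"] show "b (k mod e) = b k" "v (k mod e) = v k"
    by simp_all
qed

lemma critical_rel: "(b k + 1) * v k = b (k + 1) * v (k + 1) + v (k + 2)"
  using rel[of k] rel[of "k + 1"] by (simp add: algebra_simps)

definition deg :: "(nat \<Rightarrow> nat) \<Rightarrow> nat" where
  "deg m = (\<Sum>k<e. m k * v k)"

lemma deg_add [simp]: "deg (m \<boxplus> m') = deg m + deg m'"
  by (simp add: deg_def madd_apply algebra_simps sum.distrib)

lemma deg_pt [simp]: "k < e \<Longrightarrow> deg (pt k x) = x * v k"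
  by (simp add: deg_def pt_def if_distrib[of "\<lambda>x. x * _"] cong: if_cong)

lemma deg_cong: "\<forall>k<e. m k = m' k \<Longrightarrow> deg m = deg m'"
  by (auto simp: deg_def)

text \<open>The monomial \<open>m\<close> in \<open>eqv_move\<close> builds compatibility with
  multiplication into the generators. \<open>eqv_ext\<close> is there because exponent vectors are
  functions on all of \<open>nat\<close>, while only the values below \<open>e\<close>
  count.\<close>

inductive eqv :: "(nat \<Rightarrow> nat) \<Rightarrow> (nat \<Rightarrow> nat) \<Rightarrow> bool" where
  eqv_ext: "\<forall>k<e. m k = m' k \<Longrightarrow> eqv m m'"
| eqv_sym: "eqv m m' \<Longrightarrow> eqv m' m"
| eqv_trans: "eqv m m' \<Longrightarrow> eqv m' m'' \<Longrightarrow> eqv m m''"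
| eqv_move: "k < e \<Longrightarrow>
    eqv (m \<boxplus> pt k (b k + 1)) (m \<boxplus> (pt ((k + 1) mod e) (b (k + 1)) \<boxplus> pt ((k + 2) mod e) 1))"

lemma eqv_add: "eqv m m' \<Longrightarrow> eqv (m \<boxplus> u) (m' \<boxplus> u)"
proof (induction rule: eqv.induct)
  case (eqv_move k m)
  show ?case
    using eqv.eqv_move[OF eqv_move, of "m \<boxplus> u"] by (simp add: madd_ac)
next
  case (eqv_ext m m')
  then show ?case by (intro eqv.eqv_ext) (simp add: madd_apply)
qed (blast intro: eqv_sym eqv_trans)+

lemma eqv_deg: "eqv m m' \<Longrightarrow> deg m = deg m'"
proof (induction rule: eqv.induct)
  case (eqv_move k m)
  have "(k + 1) mod e < e" "(k + 2) mod e < e" using e_ge3 by auto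
  then show ?case using eqv_move critical_rel[of k] by (simp add: per_mod)
qed (auto intro: deg_cong)

lemma eqv_move_le:
  assumes "k < e" "m k \<ge> b k + 1"
  shows "eqv m ((\<lambda>i. if i = k then m k - (b k + 1) else m i) \<boxplus>
    (pt ((k + 1) mod e) (b (k + 1)) \<boxplus> pt ((k + 2) mod e) 1))"
proof -
  let ?m = "\<lambda>i. if i = k then m k - (b k + 1) else m i"
  have "m = ?m \<boxplus> pt k (b k + 1)"
    using assms by (auto simp: pt_def madd_apply fun_eq_iff)
  moreover have "eqv (?m \<boxplus> pt k (b k + 1)) (?m \<boxplus> (pt ((k + 1) mod e) (b (k + 1)) \<boxplus> pt ((k + 2) mod e) 1))"
    by (rule eqv_move[OF assms(1)])
  ultimately show ?thesis by simp
qed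

section \<open>Reducible monomials and normal forms\<close>

definition odds :: "nat \<Rightarrow> nat \<Rightarrow> nat" where
  "odds j = (\<lambda>i. if odd i \<and> i \<le> 2 * j + 1 then b i else 0)"

lemma odds_Suc: "odds (Suc j) = odds j \<boxplus> pt (2 * j + 3) (b (2 * j + 3))"
proof
  fix i
  have "odd i \<Longrightarrow> i \<le> 2 * j + 3 \<Longrightarrow> i = 2 * j + 3 \<or> i \<le> 2 * j + 1"
    by presburger
  then show "odds (Suc j) i = (odds j \<boxplus> pt (2 * j + 3) (b (2 * j + 3))) i"
    by (auto simp: odds_def pt_def madd_apply)
qed

text \<open>The generators only rewrite the case \<open>j = 0\<close>; multiplying by a power of the last variable
  makes the next generator applicable and passes from \<open>j\<close> to \<open>j + 1\<close>.\<close>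

lemma odds_reducible:
  "j < e' \<Longrightarrow> \<exists>u. eqv (odds j \<boxplus> pt (2 * j + 2) 1) (u \<boxplus> pt 0 1)"
proof (induction j)
  case 0
  have madd_0: "(\<lambda>_. 0) \<boxplus> m = m" for m by (simp add: madd_def)
  have m: "eqv ((\<lambda>_. 0) \<boxplus> pt 0 (b 0 + 1)) ((\<lambda>_. 0) \<boxplus> (pt ((0 + 1) mod e) (b (0 + 1)) \<boxplus> pt ((0 + 2) mod e) 1))"
    by (rule eqv_move) (use e_ge3 in simp)
  have "odds 0 = pt 1 (b 1)"
    by (auto simp: odds_def pt_def fun_eq_iff elim: oddE)
  then have "eqv (odds 0 \<boxplus> pt (2 * 0 + 2) 1) (pt 0 (b 0) \<boxplus> pt 0 1)"
    using eqv_sym[OF m] e_ge3 by (simp add: pt_add[symmetric] madd_0)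
  then show ?case by blast
next
  case (Suc j)
  then obtain u where u: "eqv (odds j \<boxplus> pt (2 * j + 2) 1) (u \<boxplus> pt 0 1)" by auto
  let ?k = "2 * j + 2"
  have lt: "?k + 2 < e" using Suc.prems e_eq by simp
  have "eqv (odds j \<boxplus> pt ?k (b ?k + 1)) (odds j \<boxplus> (pt ((?k + 1) mod e) (b (?k + 1)) \<boxplus> pt ((?k + 2) mod e) 1))"
    by (rule eqv_move) (use lt in simp)
  then have "eqv (odds j \<boxplus> pt ?k (b ?k + 1)) (odds (Suc j) \<boxplus> pt (2 * Suc j + 2) 1)"
    using lt unfolding odds_Suc by (simp add: madd_ac eval_nat_numeral)
  moreover have "eqv (odds j \<boxplus> pt ?k (b ?k + 1)) (u \<boxplus> pt ?k (b ?k) \<boxplus> pt 0 1)"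
    using eqv_add[OF u, of "pt ?k (b ?k)"] unfolding pt_add by (simp add: madd_ac)
  ultimately show ?case
    by (meson eqv_sym eqv_trans)
qed

text \<open>Modulo \<open>y\<^sub>0\<close> the reducible monomials are those divisible by some \<open>y\<^sub>k ^ (b k + 1)\<close> with \<open>k > 0\<close> or by some monomial of
  the preceding lemma.  In \<open>nf_block j\<close>, \<open>2 * j + 1\<close> is the first odd index whose exponent is below \<open>b\<close>;
  there is none in \<open>nf_block e'\<close>.\<close>

definition nf_block :: "nat \<Rightarrow> (nat \<Rightarrow> nat) set" where
  "nf_block j = (\<Pi>\<^sub>E i\<in>{..<e}. if i = 0 then {0} else if i < 2 * j + 1 then (if odd i then {b i} else {0})
     else if i = 2 * j + 1 then {..<b i} else {..<b i + 1})"

definition nf :: "(nat \<Rightarrow> nat) set" where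
  "nf = (\<Union>j\<le>e'. nf_block j)"

lemma finite_nf_block: "finite (nf_block j)"
  unfolding nf_block_def by (intro finite_PiE) auto

lemma card_nf_block:
  assumes "j < e'"
  shows "card (nf_block j) = b (2 * j + 1) * (\<Prod>k\<in>{2 * j + 2..<e}. b k + 1)"
proof -
  let ?c = "\<lambda>i. card (if i = 0 then {0} else if i < 2 * j + 1 then (if odd i then {b i} else {0})
     else if i = 2 * j + 1 then {..<b i} else {..<b i + 1})"
  have "card (nf_block j) = prod ?c {..<e}"
    unfolding nf_block_def by (rule card_PiE) simp
  also have "\<dots> = prod ?c {2 * j + 1..<e}"
    by (rule prod.mono_neutral_right) (use assms in \<open>auto simp: not_le not_less\<close>)
  also have "{2 * j + 1..<e} = insert (2 * j + 1) {2 * j + 2..<e}"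
    using assms e_eq by auto
  also have "prod ?c \<dots> = b (2 * j + 1) * prod ?c {2 * j + 2..<e}"
    by (subst prod.insert) auto
  also have "prod ?c {2 * j + 2..<e} = (\<Prod>k\<in>{2 * j + 2..<e}. b k + 1)"
    by (rule prod.cong) auto
  finally show ?thesis .
qed

lemma card_nf_block_top: "card (nf_block e') = 1"
proof -
  have "card (nf_block e') = (\<Prod>i<e. card (if i = 0 then {0} else if i < 2 * e' + 1 then (if odd i then {b i} else {0})
     else if i = 2 * e' + 1 then {..<b i} else {..<b i + 1}))"
    unfolding nf_block_def by (rule card_PiE) simp
  also have "\<dots> = 1"
    by (rule prod.neutral) (auto simp: e_eq)
  finally show ?thesis .
qed

lemma finite_nf: "finite nf"
  by (simp add: nf_def finite_nf_block)

text \<open>The j-th summand of \<open>v0_eq\<close> is the size of \<open>nf_block j\<close>, and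
  the leading 1 is the size of \<open>nf_block e'\<close>. An upper bound suffices: once the weights
  are coprime, hitting all residue classes gives the reverse inequality.\<close>

lemma card_nf_le: "card nf \<le> v 0"
proof -
  have "card nf \<le> (\<Sum>j\<le>e'. card (nf_block j))"
    unfolding nf_def by (rule card_UN_le) simp
  also have "{..e'} = insert e' {..<e'}" by auto
  also have "(\<Sum>j\<in>insert e' {..<e'}. card (nf_block j)) = v 0"
    by (simp add: card_nf_block card_nf_block_top v0_eq)
  finally show ?thesis .
qed

lemma nf_intro:
  assumes "m 0 = 0" "\<And>k. 0 < k \<Longrightarrow> k < e \<Longrightarrow> m k \<le> b k"
    and "\<And>j. j < e' \<Longrightarrow> (\<forall>i\<le>j. m (2 * i + 1) \<ge> b (2 * i + 1)) \<Longrightarrow> m (2 * j + 2) = 0"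
  shows "restrict m {..<e} \<in> nf"
proof -
  \<comment> \<open>The disjunct \<open>j = e'\<close> is a sentinel: it makes the least index exist
    when no odd exponent is below its maximum.\<close>
  define P where "P j \<longleftrightarrow> j = e' \<or> m (2 * j + 1) < b (2 * j + 1)" for j
  define j where "j = (LEAST j. P j)"
  have Pj: "P j" unfolding j_def by (rule LeastI[of _ e']) (simp add: P_def)
  have min: "i < j \<Longrightarrow> \<not> P i" for i unfolding j_def by (rule not_less_Least)
  have "j \<le> e'" unfolding j_def by (rule Least_le) (simp add: P_def)
  have low: "b (2 * i + 1) \<le> m (2 * i + 1)" if "i < j" for i
    using min[OF that] by (simp add: P_def)
  have even: "m (2 * i + 2) = 0" if "i < j" for i
    by (rule assms(3)) (use that \<open>j \<le> e'\<close> low in auto)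
  have "restrict m {..<e} \<in> nf_block j"
    unfolding nf_block_def
  proof (rule restrict_PiE_iff[THEN iffD2], rule ballI)
    fix i assume i: "i \<in> {..<e}"
    consider "i = 0" | l where "i = 2 * l + 1" "l < j" | l where "i = 2 * l + 2" "l < j"
      | "i = 2 * j + 1" | "i > 2 * j + 1"
    proof -
      have "i = 0 \<or> (\<exists>l<j. i = 2 * l + 1) \<or> (\<exists>l<j. i = 2 * l + 2) \<or> i = 2 * j + 1 \<or> i > 2 * j + 1"
        by presburger
      then show ?thesis using that by blast
    qed
    then show "m i \<in> (if i = 0 then {0} else if i < 2 * j + 1 then (if odd i then {b i} else {0})
     else if i = 2 * j + 1 then {..<b i} else {..<b i + 1})"
    proof cases
      case 2
      then show ?thesis using low[of l] assms(2)[of i] i by auto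
    next
      \<comment> \<open>For \<open>j = e'\<close> this index would be \<open>e\<close>, which is out
        of range; so the second disjunct of \<open>P\<close> holds.\<close>
      case 4
      then show ?thesis using Pj i e_eq by (auto simp: P_def)
    next
      case 5
      then show ?thesis using assms(2)[of i] i by auto
    qed (use assms(1) even in auto)
  qed
  then show ?thesis using \<open>j \<le> e'\<close> by (auto simp: nf_def)
qed

text \<open>Termination needs two measures. Degrees are invariant, so any step that raises the
  exponent of \<open>y_0\<close> lowers \<open>M1\<close>, the degree contributed by the other
  variables. A move at \<open>k > 0\<close> with \<open>k + 2 < e\<close> keeps \<open>M1\<close>,
  but trades a power of \<open>y_k\<close> for later variables. \<open>M2\<close> reads the
  exponents in base \<open>K\<close> with earlier variables at higher places, so it drops.\<close>

lemma nf_reduction: "\<exists>\<mu>\<in>nf. \<exists>t. eqv m (\<mu> \<boxplus> pt 0 t)"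
proof -
  \<comment> \<open>Any base with \<open>K \<ge> b (k + 1) + 2\<close> lets the removed power of
    \<open>y_k\<close> outweigh what the move adds; the sum provides one value for all
    \<open>k\<close>.\<close>
  define K where "K = 2 + (\<Sum>k<e. b k)"
  define M1 where "M1 m = deg m - m 0 * v 0" for m :: "nat \<Rightarrow> nat"
  define M2 where "M2 m = (\<Sum>k\<in>{1..<e}. m k * K ^ (e - k))" for m :: "nat \<Rightarrow> nat"
  have deg_ge: "m 0 * v 0 \<le> deg m" for m
    unfolding deg_def by (rule member_le_sum[of 0]) (use e_ge3 in auto)
  have M1_less: "M1 m' < M1 m" if "deg m = deg m'" "m 0 < m' 0" for m m'
    using that deg_ge[of m'] v_pos[of 0] unfolding M1_def
    by (metis diff_less_mono2 le_trans less_le_trans mult_less_cancel2)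
  show ?thesis
  proof (induction m rule: wf_induct_rule[OF wf_measures[of "[M1, M2]"]])
    case (1 m)
    have step: ?case if "eqv m m'" "M1 m' < M1 m \<or> M1 m' = M1 m \<and> M2 m' < M2 m" for m'
    proof -
      from 1[of m'] that(2) obtain \<mu> t where "\<mu> \<in> nf" "eqv m' (\<mu> \<boxplus> pt 0 t)" by auto
      with that(1) show ?thesis by (meson eqv_trans)
    qed
    define m0 where "m0 = m(0 := 0)"
    consider (big) k where "0 < k" "k < e" "m k \<ge> b k + 1"
      | (bad) j where "j < e'" "\<forall>i\<le>j. m (2 * i + 1) \<ge> b (2 * i + 1)" "m (2 * j + 2) > 0"
      | (good) "restrict m0 {..<e} \<in> nf"
    proof -
      have "restrict m0 {..<e} \<in> nf"
        if "\<not> (\<exists>k>0. k < e \<and> m k \<ge> b k + 1)"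
          "\<not> (\<exists>j<e'. (\<forall>i\<le>j. m (2 * i + 1) \<ge> b (2 * i + 1)) \<and> m (2 * j + 2) > 0)"
      proof (rule nf_intro)
        show "m0 k \<le> b k" if "0 < k" "k < e" for k
        proof -
          have "\<not> b k + 1 \<le> m k" using \<open>\<not> (\<exists>k>0. k < e \<and> m k \<ge> b k + 1)\<close> that by blast
          then show ?thesis using that by (simp add: m0_def)
        qed
      qed (use that(2) in \<open>auto simp: m0_def\<close>)
      then show ?thesis using big bad good by blast
    qed
    then show ?case
    proof cases
      case good
      have "eqv m (restrict m0 {..<e} \<boxplus> pt 0 (m 0))"
        by (rule eqv_ext) (auto simp: m0_def pt_def madd_apply)
      then show ?thesis using good by blast
    next
      case bad
      define r where "r i = m i - (odds j \<boxplus> pt (2 * j + 2) 1) i" for i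
      have "m i \<ge> (odds j \<boxplus> pt (2 * j + 2) 1) i" for i
        using bad by (auto simp: odds_def pt_def madd_apply elim!: oddE)
      then have m: "m = (odds j \<boxplus> pt (2 * j + 2) 1) \<boxplus> r"
        by (simp add: r_def fun_eq_iff madd_apply)
      obtain u where "eqv (odds j \<boxplus> pt (2 * j + 2) 1) (u \<boxplus> pt 0 1)"
        using odds_reducible[OF \<open>j < e'\<close>] by blast
      from eqv_add[OF this, of r] have *: "eqv m (u \<boxplus> pt 0 1 \<boxplus> r)" by (simp add: m)
      have "m 0 = r 0" by (simp add: r_def odds_def pt_def madd_apply)
      then have "M1 (u \<boxplus> pt 0 1 \<boxplus> r) < M1 m"
        using eqv_deg[OF *] by (intro M1_less) (auto simp: pt_def madd_apply)
      then show ?thesis using step[OF *] by blast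
    next
      case big
      define q where "q = pt ((k + 1) mod e) (b (k + 1)) \<boxplus> pt ((k + 2) mod e) 1"
      define m' where "m' = (\<lambda>i. if i = k then m k - (b k + 1) else m i) \<boxplus> q"
      have *: "eqv m m'"
        unfolding m'_def q_def by (rule eqv_move_le) (use big in auto)
      have dg: "deg m = deg m'" by (rule eqv_deg[OF *])
      show ?thesis
      proof (cases "k + 2 < e")
        case False
        \<comment> \<open>Here \<open>k\<close> is \<open>e - 2\<close> or \<open>e - 1\<close>, so
          one of the two variables of the tail wraps around to \<open>y_0\<close>.\<close>
        then have "q 0 > 0" using big b_pos[of "k + 1"] e_ge3
          by (cases "k + 1 = e") (auto simp: q_def pt_def madd_apply not_less le_Suc_eq)
        then have "m 0 < m' 0" using big by (simp add: m'_def madd_apply)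
        then show ?thesis using step[OF *] M1_less[OF dg] by blast
      next
        case True
        then have q: "q = pt (k + 1) (b (k + 1)) \<boxplus> pt (k + 2) 1" by (simp add: q_def)
        have "m' 0 = m 0" using big by (simp add: m'_def q pt_def madd_apply)
        then have M1: "M1 m' = M1 m" by (simp add: M1_def dg)
        have M2_add: "M2 (x \<boxplus> y) = M2 x + M2 y" for x y
          by (simp add: M2_def madd_apply algebra_simps sum.distrib)
        have M2_pt: "M2 (pt i x) = x * K ^ (e - i)" if "0 < i" "i < e" for i x
          using that by (simp add: M2_def pt_def if_distrib[of "\<lambda>x. x * _"] cong: if_cong)
        \<comment> \<open>Comparing the two measures through an equation of sums avoids truncated
          subtraction.\<close>
        have eq: "m \<boxplus> q = m' \<boxplus> pt k (b k + 1)"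
          using big by (auto simp: m'_def pt_def madd_apply fun_eq_iff)
        have 1: "M2 m + (b (k + 1) * K ^ (e - (k + 1)) + K ^ (e - (k + 2))) = M2 m' + (b k + 1) * K ^ (e - k)"
          using arg_cong[OF eq, of M2] big True by (simp add: M2_add q M2_pt)
        obtain s where s: "e = k + 2 + s" using True by (metis add.commute less_imp_add_positive)
        have "b (k + 1) \<le> (\<Sum>k<e. b k)"
          by (rule member_le_sum) (use True in auto)
        then have K: "K \<ge> b (k + 1) + 2" by (simp add: K_def)
        have "b (k + 1) * (K * K ^ s) + K ^ s < 2 * (K * (K * K ^ s))"
        proof -
          have "K ^ s > 0" using K by simp
          have "b (k + 1) * (K * K ^ s) + K ^ s \<le> (b (k + 1) + 1) * (K * K ^ s)"
            using K by (simp add: algebra_simps)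
          also have "\<dots> < K * (K * K ^ s)" using K \<open>K ^ s > 0\<close> by (intro mult_strict_right_mono) auto
          finally show ?thesis by simp
        qed
        also have "\<dots> \<le> (b k + 1) * (K * (K * K ^ s))"
          using b_pos[of k] by (intro mult_right_mono) auto
        finally have "M2 m' < M2 m" using 1 by (simp add: s)
        then show ?thesis using step[OF *] M1 by blast
      qed
    qed
  qed
qed

section \<open>Maximal normal forms and their degrees\<close>

text \<open>Below \<open>e\<close> this is the only element of \<open>nf_block e'\<close>.\<close>

definition top_odds :: "nat \<Rightarrow> nat" where
  "top_odds = (\<lambda>i. if odd i then b i else 0)"

text \<open>For \<open>j < e'\<close> this is, below \<open>e\<close>, the componentwise largest
  element of \<open>nf_block j\<close>.\<close>

definition top_block :: "nat \<Rightarrow> nat \<Rightarrow> nat" where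
  "top_block j = (\<lambda>i. if i < 2 * j + 1 then (if odd i then b i else 0)
     else if i = 2 * j + 1 then b i - 1 else b i)"

lemma restrict_top_odds: "restrict top_odds {..<e} \<in> nf"
proof -
  have "restrict top_odds {..<e} \<in> nf_block e'"
    unfolding nf_block_def restrict_PiE_iff using e_eq by (auto simp: top_odds_def)
  then show ?thesis by (auto simp: nf_def)
qed

lemma restrict_top_block: "j < e' \<Longrightarrow> restrict (top_block j) {..<e} \<in> nf"
proof -
  assume "j < e'"
  moreover have "restrict (top_block j) {..<e} \<in> nf_block j"
    unfolding nf_block_def restrict_PiE_iff
  proof
    fix i assume "i \<in> {..<e}"
    consider "i = 0" | "0 < i" "i < 2 * j + 1" | "i = 2 * j + 1" | "i > 2 * j + 1" by linarith
    then show "top_block j i \<in> (if i = 0 then {0} else if i < 2 * j + 1 then if odd i then {b i} else {0}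
         else if i = 2 * j + 1 then {..<b i} else {..<b i + 1})"
      by cases (auto simp: top_block_def b_pos)
  qed
  ultimately show ?thesis by (auto simp: nf_def)
qed

lemma nf_block_le_top:
  assumes "\<mu> \<in> nf_block j" "k < e"
  shows "\<mu> k \<le> top_block j k"
proof -
  have "\<mu> k \<in> (if k = 0 then {0} else if k < 2 * j + 1 then (if odd k then {b k} else {0})
     else if k = 2 * j + 1 then {..<b k} else {..<b k + 1})"
    using PiE_mem[OF assms(1)[unfolded nf_block_def], of k] assms(2) by simp
  then show ?thesis by (auto simp: top_block_def split: if_splits)
qed

lemma nf_block_low:
  assumes "\<mu> \<in> nf_block j" "k < e" "k < 2 * j + 1"
  shows "\<mu> k = top_odds k"
proof -
  have "\<mu> k \<in> (if k = 0 then {0} else if k < 2 * j + 1 then (if odd k then {b k} else {0})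
     else if k = 2 * j + 1 then {..<b k} else {..<b k + 1})"
    using PiE_mem[OF assms(1)[unfolded nf_block_def], of k] assms(2) by simp
  then show ?thesis using assms(3) by (auto simp: top_odds_def split: if_splits)
qed

text \<open>Used to multiply a normal form that is not the top of its block by one more variable
  without leaving the block.\<close>

lemma nf_block_between:
  assumes "\<mu> \<in> nf_block j" "j < e'" "\<And>i. i < e \<Longrightarrow> \<mu> i \<le> m i" "\<And>i. i < e \<Longrightarrow> m i \<le> top_block j i"
  shows "restrict m {..<e} \<in> nf_block j"
  unfolding nf_block_def restrict_PiE_iff
proof
  fix i assume i: "i \<in> {..<e}"
  then have "i < 2 * j + 1 \<Longrightarrow> m i = top_odds i"
    using nf_block_low[OF assms(1), of i] assms(3,4)[of i]
    by (auto simp: top_odds_def top_block_def split: if_splits)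
  moreover have "m i \<le> top_block j i" using assms(4) i by simp
  ultimately show "m i \<in> (if i = 0 then {0} else if i < 2 * j + 1 then if odd i then {b i} else {0}
         else if i = 2 * j + 1 then {..<b i} else {..<b i + 1})"
    using b_pos[of i] by (auto simp: top_block_def top_odds_def split: if_splits)
qed

text \<open>Summing \<open>rel\<close> over a full period counts every \<open>v k\<close> once more
  than the products with \<open>b\<close> and once again after the shift, and e C - 2 (e' C - d) = C
  + 2 d.\<close>

lemma sum_bv: "(\<Sum>k<e. b k * v k) = C + 2 * d"
proof -
  have "(\<Sum>k<e. v (k + 1)) = (\<Sum>k<e. v k)"
  proof -
    have "v 0 + (\<Sum>k<e. v (k + 1)) = (\<Sum>k<Suc e. v k)"
      by (simp only: sum.lessThan_Suc_shift) simp
    also have "\<dots> = (\<Sum>k<e. v k) + v 0" using v_per[of 0] by simp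
    finally show ?thesis by simp
  qed
  moreover have "(\<Sum>k<e. (b k + 1) * v k + v (k + 1)) = e * C"
    using rel by simp
  ultimately have "(\<Sum>k<e. b k * v k) + 2 * (\<Sum>k<e. v k) = (2 * e' + 1) * C"
    by (simp add: sum.distrib algebra_simps e_eq)
  then show ?thesis using d_eq by (simp add: algebra_simps)
qed

lemma sum_odd_even: "(\<Sum>k<e. f k) = f 0 + (\<Sum>j<e'. f (2 * j + 1) + (f (2 * j + 2) :: nat))"
proof -
  have "(\<Sum>k<2 * n + 1. f k) = f 0 + (\<Sum>j<n. f (2 * j + 1) + f (2 * j + 2))" for n
    by (induct n) (auto simp: algebra_simps)
  then show ?thesis by (simp only: e_eq)
qed

text \<open>Summing \<open>rel\<close> over the odd indices only gives e' C on one side, and on the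
  other the degree plus all weights except v_0; compare with \<open>d_eq\<close>.\<close>

lemma deg_top_odds: "deg top_odds = d + v 0"
proof -
  have "deg top_odds = (\<Sum>j<e'. b (2 * j + 1) * v (2 * j + 1))"
    unfolding deg_def sum_odd_even by (simp add: top_odds_def)
  moreover have "(\<Sum>j<e'. b (2 * j + 1) * v (2 * j + 1)) + (\<Sum>j<e'. v (2 * j + 1) + v (2 * j + 2)) = e' * C"
  proof -
    have "(\<Sum>j<e'. b (2 * j + 1) * v (2 * j + 1)) + (\<Sum>j<e'. v (2 * j + 1) + v (2 * j + 2)) =
        (\<Sum>j<e'. (b (2 * j + 1) + 1) * v (2 * j + 1) + v (2 * j + 1 + 1))"
      by (simp add: sum.distrib algebra_simps)
    also have "\<dots> = e' * C" by (simp only: rel) simp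
    finally show ?thesis .
  qed
  moreover have "(\<Sum>k<e. v k) = v 0 + (\<Sum>j<e'. v (2 * j + 1) + v (2 * j + 2))"
    by (rule sum_odd_even)
  ultimately show ?thesis using d_eq by linarith
qed

text \<open>The full vector \<open>b\<close> has degree C + 2 d, and \<open>top_block 0\<close>
  arises from it by removing \<open>y_0 ^ b 0\<close> and one \<open>y_1\<close>, which together
  have degree C - v_0.\<close>

lemma deg_top_block_0: "deg (top_block 0) = 2 * d + v 0"
proof -
  have "top_block 0 \<boxplus> (pt 0 (b 0) \<boxplus> pt 1 1) = b"
    using b_pos[of 1] by (auto simp: top_block_def pt_def madd_apply fun_eq_iff)
  from arg_cong[OF this, of deg] have "deg (top_block 0) + (b 0 * v 0 + v 1) = (\<Sum>k<e. b k * v k)"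
    using e_ge3 by (simp add: deg_def[of b])
  then show ?thesis using sum_bv rel[of 0] by simp
qed

text \<open>Up to the critical relation at 2 j + 1, the monomial \<open>top_block j\<close> is
  \<open>top_block (Suc j)\<close> times a power of \<open>y_(2j+1)\<close>. Consequently every top
  except \<open>top_block 0\<close> lies below another normal form and yields no pseudo-Frobenius
  number.\<close>

lemma deg_top_block_Suc: "Suc j < e' \<Longrightarrow> deg (top_block (Suc j)) + b (2 * j + 1) * v (2 * j + 1) = deg (top_block j)"
proof -
  assume j: "Suc j < e'"
  let ?k = "2 * j + 1"
  have "top_block (Suc j) \<boxplus> pt ?k (b ?k) \<boxplus> (pt (?k + 1) (b (?k + 1)) \<boxplus> pt (?k + 2) 1) = top_block j \<boxplus> pt ?k (b ?k + 1)"
  proof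
    fix i
    have "i < 2 * j + 1 \<or> i = 2 * j + 1 \<or> i = 2 * j + 2 \<or> i = 2 * j + 3 \<or> i > 2 * j + 3" by linarith
    then show "(top_block (Suc j) \<boxplus> pt ?k (b ?k) \<boxplus> (pt (?k + 1) (b (?k + 1)) \<boxplus> pt (?k + 2) 1)) i = (top_block j \<boxplus> pt ?k (b ?k + 1)) i"
      using b_pos[of "2 * j + 1"] b_pos[of "2 * j + 3"] by (auto simp: madd_apply top_block_def pt_def)
  qed
  moreover have "?k < e" "?k + 1 < e" "?k + 2 < e" using j e_eq by simp_all
  ultimately have "deg (top_block (Suc j)) + b ?k * v ?k + (b (?k + 1) * v (?k + 1) + v (?k + 2)) =
      deg (top_block j) + (b ?k + 1) * v ?k"
    by (metis deg_add deg_pt mult_1)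
  then show ?thesis unfolding critical_rel[of ?k] by simp
qed

section \<open>The semigroup of degrees\<close>

definition H :: "nat set" where
  "H = range deg"

lemma H_add: "x \<in> H \<Longrightarrow> y \<in> H \<Longrightarrow> x + y \<in> H"
  unfolding H_def by (auto simp flip: deg_add)

lemma H_0: "0 \<in> H"
  unfolding H_def by (rule range_eqI[of _ _ "\<lambda>_. 0"]) (simp add: deg_def)

lemma H_scale: "x \<in> H \<Longrightarrow> c * x \<in> H"
  by (induction c) (auto simp: H_0 H_add)

lemma H_v: "k < e \<Longrightarrow> v k \<in> H"
  unfolding H_def by (metis deg_pt mult_1 rangeI)

text \<open>The computation of \<open>deg_top_block_0\<close> rotated: removing
  \<open>y_k ^ b k\<close> and one \<open>y_(k+1)\<close> from the vector \<open>b\<close> costs C -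
  v_k.\<close>

lemma two_d_plus_v: "k < e \<Longrightarrow> 2 * d + v k \<in> H"
proof -
  assume k: "k < e"
  let ?k' = "(k + 1) mod e"
  let ?m = "\<lambda>j. if j = k then 0 else if j = ?k' then b j - 1 else b j"
  have k': "?k' < e" "?k' \<noteq> k"
    using e_ge3 k by (auto simp: mod_Suc split: if_splits)
  have "?m \<boxplus> (pt k (b k) \<boxplus> pt ?k' 1) = b"
    using k' b_pos by (auto simp: fun_eq_iff madd_apply pt_def Suc_leI)
  from arg_cong[OF this, of deg] have "deg ?m + (b k * v k + v (k + 1)) = C + 2 * d"
    using k k' sum_bv by (simp add: per_mod deg_def[of b])
  then have "deg ?m = 2 * d + v k" using rel[of k] by simp
  then show ?thesis unfolding H_def by (metis rangeI)
qed

end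

section \<open>Coprime weights: Apery set, pseudo-Frobenius numbers, isolated powers\<close>

locale coprime_cyclic_relations = cyclic_relations +
  assumes gcd_v: "Gcd (v ` {..<e}) = 1"
begin

text \<open>By coprimality the weights generate all integers as a group. Modulo \<open>v 0\<close>
  the coefficient -1 may be replaced by \<open>v 0 - 1\<close>, so differences are again congruent
  to degrees of monomials.\<close>

lemma residue_attained: "\<exists>m. deg m mod v 0 = r mod v 0"
proof -
  have scale: "deg (\<lambda>i. c * m i) = c * deg m" for c m
    by (simp add: deg_def sum_distrib_left algebra_simps)
  have "\<exists>m. [int (deg m) = s] (mod int (v 0))" if "s \<in> group_closure (int ` v ` {..<e})" for s
    using that
  proof induction
    case (base s)
    then consider "s = 0" | k where "k < e" "s = int (v k)" by auto
    then show ?case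
    proof cases
      case 1
      then show ?thesis by (intro exI[of _ "\<lambda>_. 0"]) (simp add: deg_def)
    next
      case 2
      then show ?thesis by (intro exI[of _ "pt k 1"]) simp
    qed
  next
    case (diff s t)
    then obtain m m' where "[int (deg m) = s] (mod int (v 0))" "[int (deg m') = t] (mod int (v 0))"
      by blast
    moreover have "[int (v 0 - 1) = -1] (mod int (v 0))"
      using v_pos[of 0] by (simp add: cong_iff_dvd_diff of_nat_diff Suc_leI)
    ultimately have "[int (deg m) + int (v 0 - 1) * int (deg m') = s + (-1) * t] (mod int (v 0))"
      by (intro cong_add cong_mult)
    then show ?case
      by (intro exI[of _ "m \<boxplus> (\<lambda>i. (v 0 - 1) * m' i)"]) (simp add: scale)
  qed
  moreover have "1 \<in> group_closure (int ` v ` {..<e})"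
    using Gcd_in_group_closure[of "int ` v ` {..<e}"] by (simp add: gcd_v del: image_image)
  ultimately obtain m where "[int (deg m) = int 1] (mod int (v 0))" by auto
  then have "[deg m = 1] (mod v 0)" by (simp only: cong_int_iff)
  then have "[r * deg m = r * 1] (mod v 0)" by (intro cong_mult) auto
  then show ?thesis
    by (intro exI[of _ "\<lambda>i. r * m i"]) (simp add: scale cong_def)
qed

text \<open>There are at most \<open>v 0\<close> normal forms and they represent all residue classes modulo \<open>v 0\<close>.\<close>

lemma nf_residue_inj: "inj_on (\<lambda>m. deg m mod v 0) nf"
proof -
  have "{..<v 0} \<subseteq> (\<lambda>m. deg m mod v 0) ` nf"
  proof
    fix r assume "r \<in> {..<v 0}"
    moreover obtain m where "deg m mod v 0 = r mod v 0" using residue_attained by blast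
    moreover obtain \<mu> t where "\<mu> \<in> nf" "eqv m (\<mu> \<boxplus> pt 0 t)" using nf_reduction by blast
    moreover from this have "deg m = deg \<mu> + t * v 0" using eqv_deg e_ge3 by fastforce
    ultimately show "r \<in> (\<lambda>m. deg m mod v 0) ` nf" by auto
  qed
  then have "card ((\<lambda>m. deg m mod v 0) ` nf) \<ge> v 0"
    using card_mono[of "(\<lambda>m. deg m mod v 0) ` nf" "{..<v 0}"] finite_nf by simp
  then have "card ((\<lambda>m. deg m mod v 0) ` nf) = card nf"
    using card_nf_le card_image_le[OF finite_nf, of "\<lambda>m. deg m mod v 0"] by linarith
  then show ?thesis by (rule eq_card_imp_inj_on[OF finite_nf])
qed

lemma eqv_if_deg_eq:
  assumes "deg m = deg m'"
  shows "eqv m m'"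
proof -
  obtain \<mu> t where \<mu>: "\<mu> \<in> nf" "eqv m (\<mu> \<boxplus> pt 0 t)" using nf_reduction by blast
  obtain \<mu>' t' where \<mu>': "\<mu>' \<in> nf" "eqv m' (\<mu>' \<boxplus> pt 0 t')" using nf_reduction by blast
  have deg: "deg \<mu> + t * v 0 = deg \<mu>' + t' * v 0"
    using eqv_deg[OF \<mu>(2)] eqv_deg[OF \<mu>'(2)] assms e_ge3 by simp
  then have "deg \<mu> mod v 0 = deg \<mu>' mod v 0" by (metis mod_mult_self1)
  then have "\<mu> = \<mu>'" using inj_onD[OF nf_residue_inj] \<mu>(1) \<mu>'(1) by blast
  moreover from this have "t = t'" using deg v_pos[of 0] by simp
  ultimately show ?thesis using \<mu>(2) \<mu>'(2) eqv_sym eqv_trans by blast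
qed

lemma eqv_iff_deg_eq: "eqv m m' \<longleftrightarrow> deg m = deg m'"
  using eqv_if_deg_eq eqv_deg by blast

text \<open>Otherwise reducing \<open>m\<close> would produce a normal form in the residue class of
  \<open>\<mu>\<close>, hence \<open>\<mu>\<close> itself, although its degree is smaller.\<close>

lemma nf_apery:
  assumes "\<mu> \<in> nf"
  shows "deg \<mu> \<noteq> v 0 + deg m"
proof
  assume eq: "deg \<mu> = v 0 + deg m"
  obtain \<mu>' t where \<mu>': "\<mu>' \<in> nf" "eqv m (\<mu>' \<boxplus> pt 0 t)" using nf_reduction by blast
  then have deg: "deg m = deg \<mu>' + t * v 0" using eqv_deg e_ge3 by fastforce
  then have "deg \<mu> = deg \<mu>' + (t + 1) * v 0" using eq by simp
  then have "deg \<mu> mod v 0 = deg \<mu>' mod v 0" by (metis mod_mult_self1)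
  then have "\<mu> = \<mu>'" using inj_onD[OF nf_residue_inj] assms \<mu>'(1) by blast
  then show False using eq deg v_pos[of 0] by simp
qed

lemma deg_restrict [simp]: "deg (restrict m {..<e}) = deg m"
  by (rule deg_cong) simp

lemma gap_of_nf: "restrict m {..<e} \<in> nf \<Longrightarrow> x + v 0 = deg m \<Longrightarrow> x \<notin> H"
  using nf_apery[of "restrict m {..<e}"] by (metis H_def add.commute deg_restrict rangeE)

lemma d_notin_H: "d \<notin> H" and two_d_notin_H: "2 * d \<notin> H"
  using gap_of_nf[OF restrict_top_odds] gap_of_nf[OF restrict_top_block[of 0]]
    deg_top_odds deg_top_block_0 e'_pos by simp_all

text \<open>f + v_0 is the degree of a normal form, and this degree must be maximal: no other normal
  form may exceed it by a positive multiple of a weight. An element below the top of its block can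
  be enlarged by one variable, and each \<open>top_block (Suc i)\<close> lies below
  \<open>top_block i\<close>. Only \<open>top_odds\<close> and \<open>top_block 0\<close>
  remain.\<close>

lemma pseudo_frobenius_cases:
  assumes f: "f \<notin> int ` H" and fv: "\<And>k. k < e \<Longrightarrow> f + int (v k) \<in> int ` H"
  shows "f = int d \<or> f = 2 * int d"
proof -
  obtain m where m: "f + int (v 0) = int (deg m)"
    using fv[of 0] e_ge3 unfolding H_def by auto
  obtain \<mu> t where \<mu>: "\<mu> \<in> nf" "eqv m (\<mu> \<boxplus> pt 0 t)" using nf_reduction by blast
  then have deg_m: "deg m = deg \<mu> + t * v 0" using eqv_deg e_ge3 by fastforce
  have "t = 0"
  proof (rule ccontr)
    assume "t \<noteq> 0"
    then obtain s where "t = Suc s" by (cases t) auto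
    then have "f = int (deg (\<mu> \<boxplus> pt 0 s))" using m deg_m e_ge3 by simp
    then show False using f unfolding H_def by blast
  qed
  with m deg_m have f\<mu>: "f + int (v 0) = int (deg \<mu>)" by simp
  \<comment> \<open>The degree of \<open>\<nu>\<close> minus v_0 equals (f + v_k) + (c - 1) v_k,
    which lies in \<open>H\<close>; this contradicts the Apery property of
    \<open>\<nu>\<close>.\<close>
  have gap: False if "restrict \<nu> {..<e} \<in> nf" "deg \<nu> = deg \<mu> + c * v k" "k < e" "c > 0" for \<nu> c k
  proof -
    obtain x where x: "f + int (v k) = int x" "x \<in> H" using fv[OF \<open>k < e\<close>] by auto
    have "x + (c - 1) * v k \<in> H" by (intro H_add H_scale H_v x that)
    moreover have "x + (c - 1) * v k + v 0 = deg \<nu>"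
    proof -
      have "int (x + (c - 1) * v k + v 0) = f + int (v 0) + int ((c - 1 + 1) * v k)"
        unfolding of_nat_add x(1)[symmetric] by (simp add: algebra_simps)
      also have "\<dots> = int (deg \<nu>)" using f\<mu> that by simp
      finally have "int (x + (c - 1) * v k + v 0) = int (deg \<nu>)" .
      then show ?thesis by (simp only: of_nat_eq_iff)
    qed
    ultimately show False using gap_of_nf[OF that(1)] by blast
  qed
  from \<mu>(1) obtain j where j: "j \<le> e'" "\<mu> \<in> nf_block j" by (auto simp: nf_def)
  show ?thesis
  proof (cases "j = e'")
    case True
    then have "deg \<mu> = deg top_odds"
      using nf_block_low[OF j(2)] e_eq by (intro deg_cong) auto
    then show ?thesis using f\<mu> deg_top_odds by simp
  next
    case False
    then have je: "j < e'" using j by simp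
    show ?thesis
    proof (cases "\<forall>k<e. \<mu> k = top_block j k")
      case False
      then obtain k where k: "k < e" "\<mu> k < top_block j k"
        using nf_block_le_top[OF j(2)] by (metis le_neq_implies_less)
      have "restrict (\<mu> \<boxplus> pt k 1) {..<e} \<in> nf_block j"
        by (rule nf_block_between[OF j(2) je])
          (use k nf_block_le_top[OF j(2)] in \<open>auto simp: madd_apply pt_def\<close>)
      then have "restrict (\<mu> \<boxplus> pt k 1) {..<e} \<in> nf" using je by (auto simp: nf_def)
      then show ?thesis using gap[of "\<mu> \<boxplus> pt k 1" 1 k] k by simp
    next
      case True
      then have deg: "deg \<mu> = deg (top_block j)" by (rule deg_cong)
      show ?thesis
      proof (cases j)
        case 0
        then show ?thesis using f\<mu> deg deg_top_block_0 by simp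
      next
        case (Suc i)
        then show ?thesis
          using gap[of "top_block i" "b (2 * i + 1)" "2 * i + 1"] restrict_top_block[of i]
            deg_top_block_Suc[of i] je deg b_pos e_eq by simp
      qed
    qed
  qed
qed

text \<open>Neither side of a generating relation divides \<open>y\<^sub>k ^ x\<close> when \<open>x \<le> b k\<close>.\<close>

lemma eqv_pure_power:
  assumes "eqv m m'" "k < e" "x \<le> b k" "\<forall>i<e. m i = pt k x i"
  shows "\<forall>i<e. m' i = pt k x i"
proof -
  \<comment> \<open>The divisors of \<open>y_k ^ b k\<close>. A move starts and ends outside
    \<open>X\<close>, so the class of an element of \<open>X\<close> is trivial.\<close>
  define X where "X = {m. \<forall>i<e. m i \<le> pt k (b k) i}"
  have "(\<forall>i<e. m i = m' i) \<or> m \<notin> X \<and> m' \<notin> X"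
    using assms(1)
  proof induction
    case (eqv_ext m m')
    then show ?case by simp
  next
    case (eqv_sym m m')
    then show ?case by auto
  next
    case (eqv_trans m m' m'')
    then show ?case unfolding X_def by fastforce
  next
    case (eqv_move l m)
    have "\<not> (m \<boxplus> pt l (b l + 1)) l \<le> pt k (b k) l"
      by (auto simp: madd_apply pt_def)
    then have 1: "m \<boxplus> pt l (b l + 1) \<notin> X"
      using eqv_move unfolding X_def by blast
    let ?q = "pt ((l + 1) mod e) (b (l + 1)) \<boxplus> pt ((l + 2) mod e) 1"
    have lt: "(l + 1) mod e < e" "(l + 2) mod e < e" using e_ge3 by auto
    \<comment> \<open>The tail involves two distinct variables, and at most one of them is
      \<open>y_k\<close>.\<close>
    have ne: "(l + 1) mod e \<noteq> (l + 2) mod e"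
      using e_ge3 by (auto simp: mod_Suc)
    obtain i where "i < e" "i \<noteq> k" "?q i > 0"
    proof (cases "(l + 1) mod e = k")
      case True
      then show ?thesis using that[of "(l + 2) mod e"] lt ne by (simp add: madd_apply pt_def)
    next
      case False
      then show ?thesis using that[of "(l + 1) mod e"] lt b_pos by (simp add: madd_apply pt_def)
    qed
    then have "m \<boxplus> ?q \<notin> X"
      unfolding X_def by (auto simp: madd_apply pt_def intro!: exI[of _ i])
    with 1 show ?case by blast
  qed
  moreover have "m \<in> X" using assms(3,4) by (auto simp: X_def pt_def)
  ultimately show ?thesis using assms(4) by auto
qed

lemma deg_eq_pure_power:
  assumes "deg m = x * v k" "k < e" "x \<le> b k" "i < e"
  shows "m i = pt k x i"
  using eqv_pure_power[of "pt k x" m k x] assms by (auto simp: eqv_iff_deg_eq)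

end

section \<open>The cyclic linear system and its determinant\<close>

lemma prod_window_shift:
  fixes c :: "nat \<Rightarrow> 'a::comm_monoid_mult"
  assumes "\<And>k. c (k + n) = c k"
  shows "(\<Prod>k<n. c (s + k)) = (\<Prod>k<n. c k)"
proof (induction s)
  case (Suc s)
  show ?case
  proof (cases n)
    case (Suc m)
    have "(\<Prod>k<n. c (Suc s + k)) = (\<Prod>k<m. c (s + Suc k)) * c (s + n)"
      by (simp add: Suc)
    also have "\<dots> = (\<Prod>k<n. c (s + k))"
      using assms[of s] by (subst Suc, subst prod.lessThan_Suc_shift) (simp add: mult.commute)
    finally show ?thesis using Suc.IH by simp
  qed simp
qed simp

section \<open>Explicit solution of the cyclic system\<close>

text \<open>Unfolded: the alternating sum of the products c_(s+i) ... c_(s+l) for i = 1, ..., l + 1,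
  the last one empty. For l = e - 1 these are the Cramer numerators of the cyclic system.\<close>

primrec alt_prod :: "(nat \<Rightarrow> int) \<Rightarrow> nat \<Rightarrow> nat \<Rightarrow> int" where
  "alt_prod c 0 s = 1"
| "alt_prod c (Suc l) s = (\<Prod>k<Suc l. c (s + 1 + k)) - alt_prod c l (s + 1)"

text \<open>Every product except the empty one contains the last factor. Peeling at this end matters
  because periodicity identifies that factor with the coefficient at the start of the
  window.\<close>

lemma alt_prod_Suc_right:
  "alt_prod c (Suc l) s = alt_prod c l s * c (s + Suc l) + (-1) ^ Suc l"
proof (induction l arbitrary: s)
  case (Suc l)
  have "alt_prod c (Suc (Suc l)) s = (\<Prod>k<Suc (Suc l). c (s + 1 + k)) - alt_prod c (Suc l) (s + 1)"
    by simp
  also have "\<dots> = ((\<Prod>k<Suc l. c (s + 1 + k)) - alt_prod c l (s + 1)) * c (s + Suc (Suc l)) + (-1) ^ Suc (Suc l)"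
    unfolding Suc.IH by (simp add: algebra_simps)
  finally show ?case by simp
qed simp

text \<open>Peel the solution at \<open>s\<close> on the left and the one at \<open>s + 1\<close> on
  the right: the term \<open>c s * alt_prod c (2 * n - 1) (s + 1)\<close> appears with opposite
  signs and cancels. The even length gives the remaining sign +1.\<close>

lemma alt_prod_rel:
  assumes per: "\<And>k. c (k + (2 * n + 1)) = c k"
  shows "c s * alt_prod c (2 * n) s + alt_prod c (2 * n) (s + 1) = (\<Prod>k<2 * n + 1. c k) + 1"
proof (cases n)
  case 0
  then show ?thesis using prod_window_shift[of c "2 * n + 1" s] per by simp
next
  case (Suc m)
  let ?l = "2 * m + 1"
  have l: "2 * n = Suc ?l" using Suc by simp
  have "(\<Prod>k<2 * n + 1. c k) = (\<Prod>k<2 * n + 1. c (s + k))"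
    by (rule prod_window_shift[symmetric]) (rule per)
  also have "\<dots> = c s * (\<Prod>k<Suc ?l. c (s + 1 + k))"
    unfolding l by (simp only: Suc_eq_plus1[symmetric] prod.lessThan_Suc_shift) simp
  finally have 1: "(\<Prod>k<2 * n + 1. c k) = c s * (\<Prod>k<Suc ?l. c (s + 1 + k))" .
  have 2: "alt_prod c (2 * n) s = (\<Prod>k<Suc ?l. c (s + 1 + k)) - alt_prod c ?l (s + 1)"
    unfolding l by (rule alt_prod.simps)
  have 3: "alt_prod c (2 * n) (s + 1) = alt_prod c ?l (s + 1) * c s + 1"
    using per[of s] unfolding l alt_prod_Suc_right by (simp add: Suc add.commute)
  show ?thesis unfolding 1 2 3 by (simp add: algebra_simps)
qed

text \<open>Consecutive terms are paired, two products that differ by one leading factor. With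
  \<open>c k = b k + 1\<close> this is the form that shows positivity and matches the count of
  normal forms.\<close>

lemma alt_prod_even:
  "alt_prod c (2 * n) s = 1 + (\<Sum>j<n. (c (s + (2 * j + 1)) - 1) * (\<Prod>k\<in>{2 * j + 2..<2 * n + 1}. c (s + k)))"
proof (induction n arbitrary: s)
  case (Suc n)
  have prod_shift: "(\<Prod>k\<in>{x..<y}. c (s + 2 + k)) = (\<Prod>k\<in>{x + 2..<y + 2}. c (s + k))" for x y
    by (subst prod.shift_bounds_nat_ivl) (simp add: add.assoc add.commute)
  let ?P = "\<Prod>k\<in>{2..<2 * Suc n + 1}. c (s + k)"
  let ?F = "\<lambda>j. (c (s + (2 * j + 1)) - 1) * (\<Prod>k\<in>{2 * j + 2..<2 * Suc n + 1}. c (s + k))"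
  have P: "(\<Prod>k<2 * n + 1. c (s + 2 + k)) = ?P"
    using prod_shift[of 0 "2 * n + 1"] by (simp add: atLeast0LessThan eval_nat_numeral)
  have "alt_prod c (2 * Suc n) s = (\<Prod>k<2 * n + 2. c (s + 1 + k)) - (\<Prod>k<2 * n + 1. c (s + 2 + k)) + alt_prod c (2 * n) (s + 2)"
    by (simp add: eval_nat_numeral)
  moreover have "(\<Prod>k<2 * n + 2. c (s + 1 + k)) = c (s + 1) * (\<Prod>k<2 * n + 1. c (s + 2 + k))"
    using prod.lessThan_Suc_shift[of "\<lambda>k. c (s + 1 + k)" "2 * n + 1"] by (simp add: eval_nat_numeral)
  moreover have "alt_prod c (2 * n) (s + 2) = 1 + (\<Sum>j<n. ?F (Suc j))"
    unfolding Suc.IH prod_shift by (simp add: eval_nat_numeral)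
  moreover have "(\<Sum>j<Suc n. ?F j) = (c (s + 1) - 1) * ?P + (\<Sum>j<n. ?F (Suc j))"
    by (subst sum.lessThan_Suc_shift) (simp add: numeral_2_eq_2)
  ultimately show ?case unfolding P by (simp only: left_diff_distrib mult_1)
qed simp

section \<open>Determinants of the coefficient matrix and of a rank-one perturbation\<close>

definition shift_mat :: "nat \<Rightarrow> (nat \<Rightarrow> 'a::comm_ring_1) \<Rightarrow> 'a mat" where
  "shift_mat n c = mat n n (\<lambda>(i, j). if j = i then c i else if j = (i + 1) mod n then 1 else 0)"

lemma shift_mat_carrier [simp]: "shift_mat n c \<in> carrier_mat n n"
  by (simp add: shift_mat_def)

lemma shift_mat_row:
  assumes "2 \<le> n" "i < n"
  shows "(\<Sum>j<n. shift_mat n c $$ (i, j) * f j) = c i * f i + f ((i + 1) mod n)"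
proof -
  have ne: "(i + 1) mod n \<noteq> i" "(i + 1) mod n < n" using assms by (auto simp: mod_Suc)
  have "(\<Sum>j<n. shift_mat n c $$ (i, j) * f j) = (\<Sum>j\<in>{i, (i + 1) mod n}. shift_mat n c $$ (i, j) * f j)"
    by (rule sum.mono_neutral_right) (use assms ne in \<open>auto simp: shift_mat_def\<close>)
  also have "\<dots> = c i * f i + f ((i + 1) mod n)"
    using assms ne by (simp add: shift_mat_def)
  finally show ?thesis .
qed

text \<open>The last row has only two nonzero positions, the diagonal and column 0 through the
  wrap-around; their minors are upper and lower triangular.\<close>

lemma det_shift_mat:
  assumes "2 \<le> n"
  shows "det (shift_mat n c) = (\<Prod>i<n. c i) + (-1) ^ (n - 1)"
proof -
  obtain m where m: "n = Suc m" "m > 0" using assms by (cases n) auto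
  let ?A = "shift_mat n c"
  have "det ?A = (\<Sum>j<n. ?A $$ (m, j) * cofactor ?A m j)"
    by (rule laplace_expansion_row) (use m in auto)
  also have "\<dots> = c m * cofactor ?A m m + cofactor ?A m 0"
    using shift_mat_row[of n m c "cofactor ?A m"] assms m by simp
  also have "cofactor ?A m m = (\<Prod>i<m. c i)"
  proof -
    let ?B = "mat_delete ?A m m"
    have B: "?B \<in> carrier_mat m m" using mat_delete_carrier[OF shift_mat_carrier, of n c m m] m by simp
    have ent: "?B $$ (i, j) = (if j = i then c i else if j = i + 1 then 1 else 0)" if "i < m" "j < m" for i j
      using that m by (auto simp: mat_delete_def shift_mat_def)
    have "det ?B = prod_list (diag_mat ?B)"
      by (rule det_upper_triangular[OF _ B]) (use B ent in \<open>auto simp: upper_triangular_def\<close>)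
    also have "\<dots> = (\<Prod>i<m. c i)"
      unfolding prod_list_diag_prod using B ent by (auto simp: atLeast0LessThan intro!: prod.cong)
    finally show ?thesis by (simp add: cofactor_def)
  qed
  also have "cofactor ?A m 0 = (-1) ^ m"
  proof -
    let ?B = "mat_delete ?A m 0"
    have B: "?B \<in> carrier_mat m m" using mat_delete_carrier[OF shift_mat_carrier, of n c m 0] m by simp
    have ent: "?B $$ (i, j) = (if j = i then 1 else if j + 1 = i then c i else 0)" if "i < m" "j < m" for i j
      using that m by (auto simp: mat_delete_def shift_mat_def)
    have "det ?B = prod_list (diag_mat ?B)"
      by (rule det_lower_triangular[OF _ B]) (use ent in auto)
    also have "\<dots> = 1"
      unfolding prod_list_diag_prod using B ent by (auto intro!: prod.neutral)
    finally show ?thesis by (simp add: cofactor_def)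
  qed
  finally show ?thesis using m by (simp add: mult.commute)
qed

text \<open>Both sides evaluate the determinant of \<open>N\<close> bordered by a column of ones and the row \<open>b\<close>.\<close>

lemma det_sub_rank_one:
  fixes N :: "'a::idom mat"
  assumes N: "N \<in> carrier_mat n n" and D: "D \<noteq> 0"
    and w: "\<And>i. i < n \<Longrightarrow> (\<Sum>j<n. N $$ (i, j) * w j) = D"
  shows "D * det (N - mat n n (\<lambda>(i, j). b j)) = det N * (D - (\<Sum>j<n. b j * w j))"
proof -
  define u where "u = mat n 1 (\<lambda>_. 1 :: 'a)"
  define bt where "bt = mat 1 n (\<lambda>(i, j). b j)"
  define wc where "wc = mat n 1 (\<lambda>(i, j). - w i)"
  define Dm where "Dm = mat 1 1 (\<lambda>_. D)"
  have [simp]: "u \<in> carrier_mat n (Suc 0)" "bt \<in> carrier_mat (Suc 0) n"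
      "wc \<in> carrier_mat n (Suc 0)" "Dm \<in> carrier_mat (Suc 0) (Suc 0)"
    by (simp_all add: u_def bt_def wc_def Dm_def)
  define Bord where "Bord = four_block_mat N u bt (1\<^sub>m 1)"
  have Bord: "Bord \<in> carrier_mat (n + 1) (n + 1)"
    unfolding Bord_def by (rule four_block_carrier_mat) (use N in auto)
  \<comment> \<open>\<open>L\<close> subtracts the border row from the others and so clears the
    column of ones, leaving the perturbed matrix. \<open>R\<close> clears the same column by means
    of \<open>N w = D\<close>; its determinant \<open>D\<close> is the factor on the left of the
    claim.\<close>
  define L where "L = four_block_mat (1\<^sub>m n) (- u) (0\<^sub>m 1 n) (1\<^sub>m 1)"
  define R where "R = four_block_mat (1\<^sub>m n) wc (0\<^sub>m 1 n) Dm"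
  have L: "L \<in> carrier_mat (n + 1) (n + 1)" and R: "R \<in> carrier_mat (n + 1) (n + 1)"
    unfolding L_def R_def by (rule four_block_carrier_mat; simp)+
  have "L * Bord = four_block_mat (1\<^sub>m n * N + (- u) * bt) (1\<^sub>m n * u + (- u) * 1\<^sub>m 1) (0\<^sub>m 1 n * N + 1\<^sub>m 1 * bt) (0\<^sub>m 1 n * u + 1\<^sub>m 1 * 1\<^sub>m 1)"
    unfolding L_def Bord_def by (rule mult_four_block_mat) (use N in auto)
  also have "1\<^sub>m n * N + (- u) * bt = N - mat n n (\<lambda>(i, j). b j)"
    using N by (intro eq_matI) (auto simp: scalar_prod_def u_def bt_def)
  also have "1\<^sub>m n * u + (- u) * 1\<^sub>m 1 = 0\<^sub>m n 1"
    by (intro eq_matI) (auto simp: u_def)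
  also have "0\<^sub>m 1 n * N + 1\<^sub>m 1 * bt = bt"
    using N by (intro eq_matI) (auto simp: bt_def)
  also have "0\<^sub>m 1 n * u + 1\<^sub>m 1 * 1\<^sub>m 1 = (1\<^sub>m 1 :: 'a mat)"
    by (intro eq_matI) (auto simp: u_def)
  finally have "det (L * Bord) = det (N - mat n n (\<lambda>(i, j). b j)) * det (1\<^sub>m 1 :: 'a mat)"
    by (simp only:) (rule det_four_block_mat_upper_right_zero, use N in auto)
  moreover have "det L = 1"
    unfolding L_def by (subst det_four_block_mat_lower_left_zero) auto
  ultimately have 1: "det Bord = det (N - mat n n (\<lambda>(i, j). b j))"
    by (simp add: det_mult[OF L Bord])
  have "Bord * R = four_block_mat (N * 1\<^sub>m n + u * 0\<^sub>m 1 n) (N * wc + u * Dm) (bt * 1\<^sub>m n + 1\<^sub>m 1 * 0\<^sub>m 1 n) (bt * wc + 1\<^sub>m 1 * Dm)"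
    unfolding R_def Bord_def
    by (rule mult_four_block_mat[of _ n n _ 1 _ 1 _ _ n _ 1]) (use N in auto)
  also have "N * 1\<^sub>m n + u * 0\<^sub>m 1 n = N"
    using N by (intro eq_matI) (auto simp: scalar_prod_def u_def)
  also have "N * wc + u * Dm = 0\<^sub>m n 1"
  proof (intro eq_matI)
    fix i j assume "i < dim_row (0\<^sub>m n 1 :: 'a mat)" "j < dim_col (0\<^sub>m n 1 :: 'a mat)"
    then have ij: "i < n" "j = 0" by auto
    then have "(N * wc + u * Dm) $$ (i, j) = - (\<Sum>j<n. N $$ (i, j) * w j) + D"
      using N by (simp add: scalar_prod_def u_def wc_def Dm_def atLeast0LessThan sum_negf)
    then show "(N * wc + u * Dm) $$ (i, j) = 0\<^sub>m n 1 $$ (i, j)"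
      using ij w by simp
  qed (use N in \<open>auto simp: u_def Dm_def wc_def\<close>)
  also have "bt * 1\<^sub>m n + 1\<^sub>m 1 * 0\<^sub>m 1 n = bt"
    by (intro eq_matI) (auto simp: bt_def)
  finally have "Bord * R = four_block_mat N (0\<^sub>m n 1) bt (bt * wc + 1\<^sub>m 1 * Dm)" .
  moreover have "bt * wc + 1\<^sub>m 1 * Dm \<in> carrier_mat 1 1"
    by (rule carrier_matI) (auto simp: Dm_def)
  ultimately have "det (Bord * R) = det N * det (bt * wc + 1\<^sub>m 1 * Dm)"
    by (simp only:) (rule det_four_block_mat_upper_right_zero, use N in auto)
  also have "det (bt * wc + 1\<^sub>m 1 * Dm) = D - (\<Sum>j<n. b j * w j)"
    by (subst det_single) (auto simp: scalar_prod_def bt_def wc_def Dm_def atLeast0LessThan sum_negf)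
  finally have "det Bord * det R = det N * (D - (\<Sum>j<n. b j * w j))"
    by (simp add: det_mult[OF Bord R])
  moreover have "det R = D"
    unfolding R_def by (subst det_four_block_mat_lower_left_zero) (auto simp: Dm_def det_single)
  ultimately show ?thesis by (simp add: 1 mult.commute)
qed

lemma det_permute_both:
  fixes A :: "'a::comm_ring_1 mat"
  assumes A: "A \<in> carrier_mat n n" and p: "p permutes {0..<n}"
  shows "det (mat n n (\<lambda>(i, j). A $$ (p i, p j))) = det A"
proof -
  let ?B = "mat n n (\<lambda>(i, j). A $$ (p i, j))"
  have pn: "i < n \<Longrightarrow> p i < n" for i using permutes_in_image[OF p, of i] by simp
  let ?C = "mat n n (\<lambda>(i, j). A $$ (p i, p j))"
  have "?C\<^sup>T = mat n n (\<lambda>(i, j). ?B\<^sup>T $$ (p i, j))"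
    by (rule eq_matI) (auto simp: pn)
  then have "det ?C = det (mat n n (\<lambda>(i, j). ?B\<^sup>T $$ (p i, j)))"
    using det_transpose[of ?C n] by simp
  also have "\<dots> = signof p * det ?B\<^sup>T"
    by (rule det_permute_rows[OF _ p]) simp
  also have "det ?B\<^sup>T = signof p * det A"
    by (subst det_transpose) (auto intro: det_permute_rows[OF A p])
  finally show ?thesis
    by (simp flip: mult.assoc of_int_mult)
qed


text \<open>The reindexed matrix of the theorem.\<close>

definition sys_mat :: "nat \<Rightarrow> (nat \<Rightarrow> nat) \<Rightarrow> int mat" where
  "sys_mat e b = mat e e (\<lambda>(k, l). if k = l then -1
     else if (l < k \<and> even (k - l)) \<or> (k < l \<and> odd (l - k)) then int (b l) else 0)"

lemma sys_mat_carrier [simp]: "sys_mat e b \<in> carrier_mat e e"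
  by (simp add: sys_mat_def)

text \<open>Passing to the next row changes the parity of each distance, so away from columns k and
  k + 1 exactly one of the two entries is \<open>b l\<close>. Across the wrap-around this persists
  because \<open>e\<close> is odd.\<close>

lemma sys_mat_adjacent_rows:
  assumes e: "e = 2 * e' + 1" "e' > 0" and kl: "k < e" "l < e"
  shows "sys_mat e b $$ (k, l) + sys_mat e b $$ ((k + 1) mod e, l) =
    int (b l) - shift_mat e (\<lambda>k. int (b k) + 1) $$ (k, l)"
proof (cases "k + 1 = e")
  case True
  then have "k = 2 * e'" using e by simp
  then show ?thesis using e kl by (auto simp: sys_mat_def shift_mat_def)
next
  case False
  then have k: "k + 1 < e" using kl by simp
  consider "l = k" | "l = k + 1" | "k + 1 < l" | "l < k" by linarith
  then show ?thesis
  proof cases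
    case 3
    then have "l - k = Suc (l - (k + 1))" by simp
    then show ?thesis using 3 k kl by (simp add: sys_mat_def shift_mat_def)
  next
    case 4
    then have "k + 1 - l = Suc (k - l)" by simp
    then show ?thesis using 4 k kl by (simp add: sys_mat_def shift_mat_def)
  qed (use k kl in \<open>auto simp: sys_mat_def shift_mat_def\<close>)
qed

section \<open>The solution and the determinant for a periodic sequence\<close>

locale cyclic_system =
  fixes e' e :: nat and b :: "nat \<Rightarrow> nat"
  assumes e_eq: "e = 2 * e' + 1" and e'_pos: "e' > 0"
    and b_pos: "\<And>k. b k > 0" and b_per: "\<And>k. b (k + e) = b k"
    and not_all_one: "e' = 1 \<Longrightarrow> \<exists>k<e. b k \<noteq> 1"
begin

definition w :: "nat \<Rightarrow> int" where
  "w = alt_prod (\<lambda>k. int (b k) + 1) (2 * e')"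

definition D :: int where
  "D = (\<Prod>k<e. int (b k) + 1) + 1"

lemma e_ge3: "e \<ge> 3"
  using e_eq e'_pos by simp

lemma w_rel: "(int (b k) + 1) * w k + w (k + 1) = D"
  using alt_prod_rel[of "\<lambda>k. int (b k) + 1" e' k] b_per
  unfolding w_def D_def unfolding e_eq by simp

lemma w_eq: "w s = 1 + (\<Sum>j<e'. int (b (s + (2 * j + 1))) * (\<Prod>k\<in>{2 * j + 2..<e}. int (b (s + k)) + 1))"
  using alt_prod_even[of "\<lambda>k. int (b k) + 1" e' s]
  unfolding w_def unfolding e_eq by simp

lemma w_pos: "w s > 0"
proof -
  have "(\<Sum>j<e'. int (b (s + (2 * j + 1))) * (\<Prod>k\<in>{2 * j + 2..<e}. int (b (s + k)) + 1)) \<ge> 0"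
    by (intro sum_nonneg mult_nonneg_nonneg prod_nonneg) auto
  then show ?thesis unfolding w_eq by linarith
qed

lemma w_per: "w (k + e) = w k"
proof -
  have "b (k + e + i) = b (k + i)" for i using b_per[of "k + i"] by (simp add: algebra_simps)
  then show ?thesis unfolding w_eq by (simp only:)
qed

lemma mod_e: "b (k mod e) = b k" "w (k mod e) = w k"
proof -
  have *: "b (i + j * e) = b i \<and> w (i + j * e) = w i" for i j
    by (induction j) (use b_per[of "i + _ * e"] w_per[of "i + _ * e"] in \<open>auto simp: algebra_simps\<close>)
  from *[of "k mod e" "k div e"] show "b (k mod e) = b k" "w (k mod e) = w k"
    by simp_all
qed

lemma D_pos: "D > 0"
  unfolding D_def by (intro add_nonneg_pos prod_nonneg) auto

definition d :: int where
  "d = det (sys_mat e b)"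

text \<open>Left multiplication by \<open>?X\<close> adds adjacent rows and turns the matrix into
  -(N - J), where all rows of J equal \<open>b\<close>. Since \<open>e\<close> is odd,
  \<open>?X\<close> has determinant 2, and \<open>det_sub_rank_one\<close> evaluates the other side
  with det N = D.\<close>

lemma two_d: "2 * d = (\<Sum>k<e. int (b k) * w k) - D"
proof -
  let ?N = "shift_mat e (\<lambda>k. int (b k) + 1)" and ?X = "shift_mat e (\<lambda>_. 1 :: int)"
  let ?J = "mat e e (\<lambda>(i, j). int (b j))"
  have e2: "2 \<le> e" using e_ge3 by simp
  have "?X * sys_mat e b = (-1) \<cdot>\<^sub>m (?N - ?J)"
  proof (rule eq_matI)
    fix i j assume "i < dim_row ((-1) \<cdot>\<^sub>m (?N - ?J))" "j < dim_col ((-1) \<cdot>\<^sub>m (?N - ?J))"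
    then have ij: "i < e" "j < e" by auto
    have "(?X * sys_mat e b) $$ (i, j) = (\<Sum>k<e. ?X $$ (i, k) * sys_mat e b $$ (k, j))"
      using ij carrier_matD[OF sys_mat_carrier[of e b]] carrier_matD[OF shift_mat_carrier[of e "\<lambda>_. 1 :: int"]]
      by (simp add: scalar_prod_def atLeast0LessThan)
    also have "\<dots> = sys_mat e b $$ (i, j) + sys_mat e b $$ ((i + 1) mod e, j)"
      using shift_mat_row[OF e2 ij(1), of "\<lambda>_. 1 :: int" "\<lambda>k. sys_mat e b $$ (k, j)"] by simp
    also have "\<dots> = int (b j) - ?N $$ (i, j)"
      by (rule sys_mat_adjacent_rows[OF e_eq e'_pos ij])
    finally show "(?X * sys_mat e b) $$ (i, j) = ((-1) \<cdot>\<^sub>m (?N - ?J)) $$ (i, j)"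
      using ij carrier_matD[OF shift_mat_carrier[of e "\<lambda>k. int (b k) + 1"]] by simp
  qed (auto simp: sys_mat_def shift_mat_def)
  then have "det ?X * d = (-1) ^ e * det (?N - ?J)"
    unfolding d_def by (subst det_mult[symmetric, of _ e]) (auto simp: det_smult)
  moreover have "det ?X = 2"
    using det_shift_mat[OF e2, of "\<lambda>_. 1 :: int"] by (simp add: e_eq)
  moreover have "D * det (?N - ?J) = det ?N * (D - (\<Sum>k<e. int (b k) * w k))"
  proof (rule det_sub_rank_one)
    fix i assume "i < e"
    then show "(\<Sum>j<e. ?N $$ (i, j) * w j) = D"
      by (subst shift_mat_row[OF e2]) (use w_rel[of i] in \<open>auto simp: mod_e\<close>)
  qed (use D_pos in auto)
  moreover have "det ?N = D"
    unfolding D_def using det_shift_mat[OF e2, of "\<lambda>k. int (b k) + 1"] e_eq by simp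
  ultimately show ?thesis using D_pos by (simp add: e_eq)
qed

lemma sum_w_Suc: "(\<Sum>k<e. w (k + 1)) = (\<Sum>k<e. w k)"
proof -
  have "w 0 + (\<Sum>k<e. w (k + 1)) = (\<Sum>k<Suc e. w k)"
    by (simp only: sum.lessThan_Suc_shift) simp
  also have "\<dots> = (\<Sum>k<e. w k) + w 0" using w_per[of 0] by simp
  finally show ?thesis by simp
qed

lemma sum_rel: "(\<Sum>k<e. int (b k) * w k) + 2 * (\<Sum>k<e. w k) = int e * D"
proof -
  have "(\<Sum>k<e. (int (b k) + 1) * w k + w (k + 1)) = int e * D"
    by (simp only: w_rel) simp
  then show ?thesis by (simp add: sum.distrib sum_w_Suc[simplified] algebra_simps)
qed

lemma d_sum: "d + (\<Sum>k<e. w k) = int e' * D"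
  using two_d sum_rel by (simp add: e_eq algebra_simps)

text \<open>By \<open>two_d\<close> the sum of the b_k w_k must exceed D. For e \<ge> 5 a crude
  bound on each term suffices; for e = 3 the margin can vanish, and the excluded vector
  enters.\<close>

lemma d_pos: "d > 0"
proof (cases "e' = 1")
  case True
  then have e3: "e = 3" by (simp add: e_eq)
  obtain k where k: "k < e" "b k \<noteq> 1" using not_all_one True by blast
  \<comment> \<open>For e = 3, \<open>sum_rel\<close> reads (sum of b_k w_k) + 2 (sum of w_k) = 3 D,
    so it is enough that the first sum is the larger of the two.\<close>
  have "(\<Sum>k<e. (int (b k) - 1) * w k) > 0"
  proof (rule sum_pos2[of _ k])
    show "0 < (int (b k) - 1) * w k"
      using k b_pos[of k] w_pos by (intro mult_pos_pos) auto
    show "0 \<le> (int (b i) - 1) * w i" for i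
      using b_pos[of i] w_pos[of i] by (intro mult_nonneg_nonneg) auto
  qed (use k in auto)
  then have "(\<Sum>k<e. int (b k) * w k) - (\<Sum>k<e. w k) > 0"
    by (simp add: algebra_simps sum_subtractf)
  then show ?thesis using two_d sum_rel e3 by simp
next
  case False
  \<comment> \<open>From b \<ge> 1 one gets w_(k+1) < D / 2, hence (b_k + 1) w_k > D / 2, and b_k is
    at least half of b_k + 1. At least five such terms exceed D.\<close>
  have "D < 4 * (int (b k) * w k)" for k
  proof -
    have "2 * w (k + 1) \<le> (int (b (k + 1)) + 1) * w (k + 1)"
      using b_pos[of "k + 1"] w_pos[of "k + 1"] by (intro mult_right_mono) auto
    then have "2 * w (k + 1) < D" using w_rel[of "k + 1"] w_pos[of "k + 1 + 1"] by linarith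
    then have "D < 2 * ((int (b k) + 1) * w k)" using w_rel[of k] by linarith
    moreover have "(int (b k) + 1) * w k \<le> (2 * int (b k)) * w k"
      using b_pos[of k] w_pos[of k] by (intro mult_right_mono) auto
    ultimately show ?thesis by linarith
  qed
  then have "(\<Sum>k<e. D) \<le> (\<Sum>k<e. 4 * (int (b k) * w k))"
    by (intro sum_mono) (simp add: less_imp_le)
  then have "int e * D \<le> 4 * (2 * d + D)"
    using two_d by (simp flip: sum_distrib_left)
  moreover have "5 * D \<le> int e * D" using False e'_pos e_eq D_pos by (intro mult_right_mono) auto
  ultimately have "5 * D \<le> 4 * (2 * d + D)" by (rule order_trans[rotated])
  then show ?thesis using D_pos by simp
qed

text \<open>Adjacent row sums add up to 2 d cyclically, so the row sums alternate between two
  values; going once around an odd cycle forces both to be d.\<close>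

lemma sys_mat_w:
  assumes "k < e"
  shows "(\<Sum>l<e. sys_mat e b $$ (k, l) * w l) = d"
proof -
  define r where "r k = (\<Sum>l<e. sys_mat e b $$ (k, l) * w l)" for k
  have e2: "2 \<le> e" using e_ge3 by simp
  have adj: "r k + r ((k + 1) mod e) = 2 * d" if "k < e" for k
  proof -
    let ?N = "shift_mat e (\<lambda>k. int (b k) + 1)"
    have "r k + r ((k + 1) mod e) = (\<Sum>l<e. (int (b l) - ?N $$ (k, l)) * w l)"
      unfolding r_def sum.distrib[symmetric] distrib_right[symmetric]
      by (intro sum.cong) (use sys_mat_adjacent_rows[OF e_eq e'_pos that] in auto)
    also have "\<dots> = (\<Sum>l<e. int (b l) * w l) - D"
      using shift_mat_row[OF e2 that, of "\<lambda>k. int (b k) + 1" w] w_rel[of k]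
      by (simp add: left_diff_distrib sum_subtractf mod_e)
    finally show ?thesis using two_d by simp
  qed
  have alt: "r k = (if even k then r 0 else 2 * d - r 0)" if "k < e" for k
    using that
  proof (induction k)
    case (Suc k)
    then show ?case using adj[of k] by (auto split: if_splits)
  qed simp
  have "r (2 * e') + r 0 = 2 * d" using adj[of "2 * e'"] by (simp add: e_eq)
  moreover have "r (2 * e') = r 0" using alt[of "2 * e'"] by (simp add: e_eq)
  ultimately have "r 0 = d" by simp
  then show ?thesis using alt[OF assms] unfolding r_def by (simp split: if_splits)
qed

end

section \<open>The polynomial ring and the toric ideal\<close>

lemma poly_mapping_sum_singles:
  fixes p :: "'a \<Rightarrow>\<^sub>0 'b::comm_monoid_add"
  assumes "finite S" "Poly_Mapping.keys p \<subseteq> S"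
  shows "p = (\<Sum>m\<in>S. Poly_Mapping.single m (Poly_Mapping.lookup p m))"
proof (rule poly_mapping_eqI)
  fix k
  have "Poly_Mapping.lookup (\<Sum>m\<in>S. Poly_Mapping.single m (Poly_Mapping.lookup p m)) k =
      (\<Sum>m\<in>S. if m = k then Poly_Mapping.lookup p m else 0)"
    by (simp add: lookup_sum lookup_single when_def)
  also have "\<dots> = Poly_Mapping.lookup p k"
    using assms by (auto simp: in_keys_iff)
  finally show "Poly_Mapping.lookup p k =
      Poly_Mapping.lookup (\<Sum>m\<in>S. Poly_Mapping.single m (Poly_Mapping.lookup p m)) k" by simp
qed

lemma times_eq_sum_singles:
  fixes p q :: "'a::monoid_add \<Rightarrow>\<^sub>0 'b::semiring_0"
  shows "p * q = (\<Sum>u\<in>Poly_Mapping.keys p. \<Sum>w\<in>Poly_Mapping.keys q.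
    Poly_Mapping.single (u + w) (Poly_Mapping.lookup p u * Poly_Mapping.lookup q w))"
proof -
  have "p * q = (\<Sum>u\<in>Poly_Mapping.keys p. Poly_Mapping.single u (Poly_Mapping.lookup p u)) *
      (\<Sum>w\<in>Poly_Mapping.keys q. Poly_Mapping.single w (Poly_Mapping.lookup q w))"
    by (rule arg_cong2[where f = "(*)"]; rule poly_mapping_sum_singles) auto
  then show ?thesis by (simp add: sum_product mult_single)
qed

lemma mem_carrier_mpoly_ring:
  "p \<in> carrier (mpoly_ring e) \<longleftrightarrow> (\<forall>m\<in>Poly_Mapping.keys p. Poly_Mapping.keys m \<subseteq> {..<e})"
  by (simp add: mpoly_ring_def)

lemma mpoly_ring_simps [simp]:
  "p \<otimes>\<^bsub>mpoly_ring e\<^esub> q = p * q" "p \<oplus>\<^bsub>mpoly_ring e\<^esub> q = p + q"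
  "\<one>\<^bsub>mpoly_ring e\<^esub> = 1" "\<zero>\<^bsub>mpoly_ring e\<^esub> = 0"
  by (simp_all add: mpoly_ring_def)

lemma carrier_mpoly_ring_closed:
  "0 \<in> carrier (mpoly_ring e)" "1 \<in> carrier (mpoly_ring e)"
  "p \<in> carrier (mpoly_ring e) \<Longrightarrow> q \<in> carrier (mpoly_ring e) \<Longrightarrow> p + q \<in> carrier (mpoly_ring e)"
  "p \<in> carrier (mpoly_ring e) \<Longrightarrow> q \<in> carrier (mpoly_ring e) \<Longrightarrow> p * q \<in> carrier (mpoly_ring e)"
  "p \<in> carrier (mpoly_ring e) \<Longrightarrow> - p \<in> carrier (mpoly_ring e)"
proof -
  show "p * q \<in> carrier (mpoly_ring e)" if "p \<in> carrier (mpoly_ring e)" "q \<in> carrier (mpoly_ring e)"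
    unfolding mem_carrier_mpoly_ring
  proof
    fix m assume "m \<in> Poly_Mapping.keys (p * q)"
    then obtain u w where "m = u + w" "u \<in> Poly_Mapping.keys p" "w \<in> Poly_Mapping.keys q"
      using keys_mult[of p q] by blast
    then show "Poly_Mapping.keys m \<subseteq> {..<e}"
      using that keys_add[of u w] unfolding mem_carrier_mpoly_ring by blast
  qed
  show "p + q \<in> carrier (mpoly_ring e)" if "p \<in> carrier (mpoly_ring e)" "q \<in> carrier (mpoly_ring e)"
    using that keys_add[of p q] unfolding mem_carrier_mpoly_ring by blast
  show "- p \<in> carrier (mpoly_ring e)" if "p \<in> carrier (mpoly_ring e)"
    using that unfolding mem_carrier_mpoly_ring by (simp add: in_keys_iff)
qed (auto simp: mem_carrier_mpoly_ring)

lemma carrier_mpoly_ring_diff: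
  "p \<in> carrier (mpoly_ring e) \<Longrightarrow> q \<in> carrier (mpoly_ring e) \<Longrightarrow> p - q \<in> carrier (mpoly_ring e)"
  using carrier_mpoly_ring_closed(3)[of p e "- q"] carrier_mpoly_ring_closed(5)[of q e] by simp

lemma single_mem_carrier: "Poly_Mapping.keys m \<subseteq> {..<e} \<Longrightarrow> Poly_Mapping.single m c \<in> carrier (mpoly_ring e)"
  by (auto simp: mem_carrier_mpoly_ring)

lemma ring_mpoly_ring: "ring (mpoly_ring e)"
proof -
  have "abelian_group (mpoly_ring e)"
  proof (rule abelian_groupI)
    fix x assume "x \<in> carrier (mpoly_ring e)"
    then show "\<exists>y\<in>carrier (mpoly_ring e). y \<oplus>\<^bsub>mpoly_ring e\<^esub> x = \<zero>\<^bsub>mpoly_ring e\<^esub>"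
      by (intro bexI[of _ "- x"]) (auto intro: carrier_mpoly_ring_closed)
  qed (auto intro: carrier_mpoly_ring_closed simp: add_ac)
  moreover have "Group.comm_monoid (mpoly_ring e)"
    by (rule comm_monoidI) (auto intro: carrier_mpoly_ring_closed simp: mult_ac)
  ultimately have "cring (mpoly_ring e)"
    by (rule cringI) (simp add: distrib_right)
  then show ?thesis by (rule cring.axioms)
qed

lemma a_inv_mpoly_ring:
  assumes "p \<in> carrier (mpoly_ring e)"
  shows "\<ominus>\<^bsub>mpoly_ring e\<^esub> p = - p"
proof -
  interpret ring "mpoly_ring e" by (rule ring_mpoly_ring)
  show ?thesis
    using minus_equality[of "- p" p] assms carrier_mpoly_ring_closed(5)[OF assms] by simp
qed

lemma ideal_mpoly_ringI:
  fixes J :: "'k::field mpoly set"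
  assumes "J \<subseteq> carrier (mpoly_ring e)" "0 \<in> J" "\<And>p q. p \<in> J \<Longrightarrow> q \<in> J \<Longrightarrow> p + q \<in> J"
    and mult: "\<And>p q. p \<in> carrier (mpoly_ring e) \<Longrightarrow> q \<in> J \<Longrightarrow> p * q \<in> J"
  shows "ideal J (mpoly_ring e)"
proof (rule idealI[OF ring_mpoly_ring])
  have minus: "- p \<in> J" if "p \<in> J" for p
    using mult[of "- 1" p] that carrier_mpoly_ring_closed(2,5) by fastforce
  show "subgroup J (add_monoid (mpoly_ring e))"
  proof (rule subgroup.intro)
    show "inv\<^bsub>add_monoid (mpoly_ring e)\<^esub> p \<in> J" if "p \<in> J" for p
      using minus[OF that] a_inv_mpoly_ring[of p e] that assms(1) by (auto simp only: a_inv_def)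
  qed (use assms(1-3) in auto)
  show "x \<otimes>\<^bsub>mpoly_ring e\<^esub> a \<in> J" if "a \<in> J" "x \<in> carrier (mpoly_ring e)" for a x
    using mult that by simp
  show "a \<otimes>\<^bsub>mpoly_ring e\<^esub> x \<in> J" if "a \<in> J" "x \<in> carrier (mpoly_ring e)" for a x
    using mult[of x a] that by (simp add: mult.commute)
qed

lemma ideal_mpoly_ringD:
  fixes J :: "'k::field mpoly set"
  assumes J: "ideal J (mpoly_ring e)"
  shows "0 \<in> J" "p \<in> J \<Longrightarrow> q \<in> J \<Longrightarrow> p + q \<in> J"
    "r \<in> carrier (mpoly_ring e) \<Longrightarrow> q \<in> J \<Longrightarrow> r * q \<in> J" "p \<in> J \<Longrightarrow> - p \<in> J"
    "J \<subseteq> carrier (mpoly_ring e)"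
proof -
  interpret ideal J "mpoly_ring e" by (rule J)
  show "0 \<in> J" "p \<in> J \<Longrightarrow> q \<in> J \<Longrightarrow> p + q \<in> J" "J \<subseteq> carrier (mpoly_ring e)"
    using additive_subgroup.zero_closed[OF additive_subgroup_axioms]
      additive_subgroup.a_closed[OF additive_subgroup_axioms]
      additive_subgroup.a_subset[OF additive_subgroup_axioms] by fastforce+
  show mult: "r \<in> carrier (mpoly_ring e) \<Longrightarrow> q \<in> J \<Longrightarrow> r * q \<in> J" for r q
    using I_l_closed by fastforce
  show "p \<in> J \<Longrightarrow> - p \<in> J"
    using mult[of "- 1" p] carrier_mpoly_ring_closed(2,5) by fastforce
qed

lemma Idl_mpoly_ring:
  assumes "G \<subseteq> carrier (mpoly_ring e)"
  shows "ideal (Idl\<^bsub>mpoly_ring e\<^esub> G) (mpoly_ring e)" "G \<subseteq> Idl\<^bsub>mpoly_ring e\<^esub> G"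
  using ring.genideal_ideal[OF ring_mpoly_ring assms] ring.genideal_self[OF ring_mpoly_ring assms] .

lemma Idl_mpoly_ring_minimal:
  "ideal J (mpoly_ring e) \<Longrightarrow> G \<subseteq> J \<Longrightarrow> Idl\<^bsub>mpoly_ring e\<^esub> G \<subseteq> J"
  by (rule ring.genideal_minimal[OF ring_mpoly_ring])

section \<open>Weighted degree and the toric homomorphism\<close>

definition wdeg :: "(nat \<Rightarrow> nat) \<Rightarrow> (nat \<Rightarrow>\<^sub>0 nat) \<Rightarrow> nat" where
  "wdeg n m = (\<Sum>i\<in>Poly_Mapping.keys m. Poly_Mapping.lookup m i * n i)"

lemma wdeg_superset:
  assumes "finite S" "Poly_Mapping.keys m \<subseteq> S"
  shows "wdeg n m = (\<Sum>i\<in>S. Poly_Mapping.lookup m i * n i)"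
  unfolding wdeg_def using assms by (intro sum.mono_neutral_left) (auto simp: in_keys_iff)

lemma wdeg_add: "wdeg n (m + m') = wdeg n m + wdeg n m'"
proof -
  let ?S = "Poly_Mapping.keys m \<union> Poly_Mapping.keys m'"
  have "wdeg n u = (\<Sum>i\<in>?S. Poly_Mapping.lookup u i * n i)" if "u \<in> {m, m', m + m'}" for u
    by (rule wdeg_superset) (use that keys_add[of m m'] in auto)
  then show ?thesis
    by (simp add: lookup_add distrib_right sum.distrib)
qed

lemma wdeg_single [simp]: "wdeg n (Poly_Mapping.single i x) = x * n i"
  by (simp add: wdeg_def)

lemma toric_map_eq:
  assumes "finite S" "Poly_Mapping.keys p \<subseteq> S"
  shows "toric_map n p = (\<Sum>m\<in>S. monom (Poly_Mapping.lookup p m) (wdeg n m))"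
proof -
  have "smult c (\<Prod>i\<in>Poly_Mapping.keys m. monom 1 (n i) ^ Poly_Mapping.lookup m i) = monom c (wdeg n m)"
    for c :: 'a and m
  proof -
    have "(\<Prod>i\<in>A. monom (1::'a) (n i) ^ Poly_Mapping.lookup m i) = monom 1 (\<Sum>i\<in>A. Poly_Mapping.lookup m i * n i)"
      if "finite A" for A
      using that by induction (auto simp: monom_power mult_monom mult.commute)
    then show ?thesis by (simp add: wdeg_def smult_monom)
  qed
  then have "toric_map n p = (\<Sum>m\<in>Poly_Mapping.keys p. monom (Poly_Mapping.lookup p m) (wdeg n m))"
    by (simp add: toric_map_def)
  also have "\<dots> = (\<Sum>m\<in>S. monom (Poly_Mapping.lookup p m) (wdeg n m))"
    using assms by (intro sum.mono_neutral_left) (auto simp: in_keys_iff)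
  finally show ?thesis .
qed

lemma toric_map_0 [simp]: "toric_map n 0 = 0"
  by (simp add: toric_map_def)

lemma toric_map_add: "toric_map n (p + q) = toric_map n p + toric_map n q"
proof -
  let ?S = "Poly_Mapping.keys p \<union> Poly_Mapping.keys q"
  have "toric_map n r = (\<Sum>m\<in>?S. monom (Poly_Mapping.lookup r m) (wdeg n m))" if "r \<in> {p, q, p + q}" for r
    by (rule toric_map_eq) (use that keys_add[of p q] in auto)
  then show ?thesis
    by (simp add: lookup_add sum.distrib flip: add_monom)
qed

lemma toric_map_sum: "toric_map n (sum f A) = (\<Sum>i\<in>A. toric_map n (f i))"
  by (induction A rule: infinite_finite_induct) (auto simp: toric_map_add)

lemma toric_map_single [simp]: "toric_map n (Poly_Mapping.single m c) = monom c (wdeg n m)"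
  by (subst toric_map_eq[of "{m}"]) auto

lemma toric_map_mult: "toric_map n (p * q) = toric_map n p * toric_map n q"
proof -
  have "toric_map n (p * q) = (\<Sum>u\<in>Poly_Mapping.keys p. \<Sum>w\<in>Poly_Mapping.keys q.
      monom (Poly_Mapping.lookup p u) (wdeg n u) * monom (Poly_Mapping.lookup q w) (wdeg n w))"
    by (subst times_eq_sum_singles) (simp add: toric_map_sum wdeg_add mult_monom)
  also have "\<dots> = toric_map n p * toric_map n q"
    by (simp add: toric_map_eq[OF finite_keys order_refl] sum_product)
  finally show ?thesis .
qed

lemma toric_map_minus: "toric_map n (p - q) = toric_map n p - toric_map n q"
  using toric_map_add[of n "p - q" q] by (simp add: algebra_simps)

lemma ideal_toric_ideal: "ideal (toric_ideal e n) (mpoly_ring e)"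
  by (rule ideal_mpoly_ringI)
    (auto simp: toric_ideal_def toric_map_add toric_map_mult intro: carrier_mpoly_ring_closed)

lemma coeff_toric_map:
  "poly.coeff (toric_map n p) k = (\<Sum>m\<in>{m \<in> Poly_Mapping.keys p. wdeg n m = k}. Poly_Mapping.lookup p m)"
  by (simp add: toric_map_eq[OF finite_keys order_refl] coeff_sum sum.inter_filter)

text \<open>A monomial alone in its weighted degree contributes its coefficient unchanged to the
  image in k[t].\<close>

lemma toric_ideal_lookup_isolated:
  assumes p: "p \<in> toric_ideal e n"
    and iso: "\<And>m'. Poly_Mapping.keys m' \<subseteq> {..<e} \<Longrightarrow> wdeg n m' = wdeg n m \<Longrightarrow> m' = m"
  shows "Poly_Mapping.lookup p m = 0"
proof (rule ccontr)
  assume nz: "Poly_Mapping.lookup p m \<noteq> 0"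
  then have "{m' \<in> Poly_Mapping.keys p. wdeg n m' = wdeg n m} = {m}"
    using iso p by (auto simp: toric_ideal_def mem_carrier_mpoly_ring in_keys_iff)
  then have "Poly_Mapping.lookup p m = poly.coeff (toric_map n p) (wdeg n m)"
    by (simp add: coeff_toric_map)
  then show False using nz p by (simp add: toric_ideal_def)
qed

text \<open>Replace each monomial of p by one representative of its degree. The coefficients
  collected on a representative add up to a coefficient of the image of p, which is zero, so p
  equals the sum of the corresponding binomials.\<close>

lemma toric_ideal_subset:
  fixes J :: "'k::field mpoly set"
  assumes J: "ideal J (mpoly_ring e)"
    and diff: "\<And>m m'. Poly_Mapping.keys m \<subseteq> {..<e} \<Longrightarrow> Poly_Mapping.keys m' \<subseteq> {..<e} \<Longrightarrow>
      wdeg n m = wdeg n m' \<Longrightarrow> Poly_Mapping.single m 1 - Poly_Mapping.single m' 1 \<in> J"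
  shows "toric_ideal e n \<subseteq> J"
proof
  fix p :: "'k mpoly" assume p: "p \<in> toric_ideal e n"
  let ?K = "Poly_Mapping.keys p" and ?l = "Poly_Mapping.lookup p"
  have K: "m \<in> ?K \<Longrightarrow> Poly_Mapping.keys m \<subseteq> {..<e}" for m
    using p by (auto simp: toric_ideal_def mem_carrier_mpoly_ring)
  define rep where "rep k = (SOME m. m \<in> ?K \<and> wdeg n m = k)" for k
  have rep: "rep (wdeg n m) \<in> ?K \<and> wdeg n (rep (wdeg n m)) = wdeg n m" if "m \<in> ?K" for m
    unfolding rep_def by (rule someI[of _ m]) (use that in simp)
  have sum_mem: "sum f A \<in> J" if "\<And>a. a \<in> A \<Longrightarrow> f a \<in> J" for f :: "(nat \<Rightarrow>\<^sub>0 nat) \<Rightarrow> 'k mpoly" and A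
    using that ideal_mpoly_ringD(1,2)[OF J] by (induction A rule: infinite_finite_induct) auto
  have "(\<Sum>m\<in>?K. Poly_Mapping.single (rep (wdeg n m)) (?l m)) =
      (\<Sum>k\<in>wdeg n ` ?K. \<Sum>m\<in>{m\<in>?K. wdeg n m = k}. Poly_Mapping.single (rep (wdeg n m)) (?l m))"
    by (rule sum.image_gen) simp
  also have "\<dots> = (\<Sum>k\<in>wdeg n ` ?K. Poly_Mapping.single (rep k) (poly.coeff (toric_map n p) k))"
  proof (rule sum.cong[OF refl])
    fix k
    have "(\<Sum>m\<in>A. Poly_Mapping.single (rep k) (?l m)) = Poly_Mapping.single (rep k) (sum ?l A)" for A
      by (induction A rule: infinite_finite_induct) (auto simp: single_add)
    then show "(\<Sum>m\<in>{m\<in>?K. wdeg n m = k}. Poly_Mapping.single (rep (wdeg n m)) (?l m)) =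
        Poly_Mapping.single (rep k) (poly.coeff (toric_map n p) k)"
      by (simp add: coeff_toric_map)
  qed
  also have "\<dots> = 0" using p by (simp add: toric_ideal_def)
  finally have "p = p - (\<Sum>m\<in>?K. Poly_Mapping.single (rep (wdeg n m)) (?l m))" by simp
  also have "\<dots> = (\<Sum>m\<in>?K. Poly_Mapping.single m (?l m) - Poly_Mapping.single (rep (wdeg n m)) (?l m))"
    using poly_mapping_sum_singles[OF finite_keys order_refl, of p] by (simp add: sum_subtractf)
  also have "\<dots> = (\<Sum>m\<in>?K. Poly_Mapping.single 0 (?l m) * (Poly_Mapping.single m 1 - Poly_Mapping.single (rep (wdeg n m)) 1))"
    by (simp add: right_diff_distrib mult_single)
  also have "\<dots> \<in> J"
  proof (rule sum_mem)
    fix m assume m: "m \<in> ?K"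
    show "Poly_Mapping.single 0 (?l m) * (Poly_Mapping.single m 1 - Poly_Mapping.single (rep (wdeg n m)) 1) \<in> J"
      by (intro ideal_mpoly_ringD(3)[OF J] diff single_mem_carrier) (use rep[OF m] K m in auto)
  qed
  finally show "p \<in> J" .
qed

section \<open>Lower bound for the number of generators\<close>

text \<open>A rank bound: the identity of size \<open>e\<close> factors through a space of dimension
  \<open>card G\<close>. Padding both factors with zeros to size \<open>e\<close> reduces it to
  determinants, since a zero column appears when \<open>card G < e\<close>.\<close>

lemma card_le_of_factorization:
  fixes X :: "nat \<Rightarrow> 'b \<Rightarrow> 'k::field"
  assumes G: "finite G" and eq: "\<And>i j. i < e \<Longrightarrow> j < e \<Longrightarrow> (\<Sum>g\<in>G. X i g * Y g j) = (if i = j then 1 else 0)"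
  shows "e \<le> card G"
proof (rule ccontr)
  assume "\<not> e \<le> card G"
  then have lt: "card G < e" by simp
  obtain h where h: "bij_betw h {0..<card G} G" using ex_bij_betw_nat_finite[OF G] by blast
  define A where "A = mat e e (\<lambda>(i, s). if s < card G then X i (h s) else 0)"
  define B where "B = mat e e (\<lambda>(s, j). if s < card G then Y (h s) j else 0)"
  have AB: "A \<in> carrier_mat e e" "B \<in> carrier_mat e e" by (simp_all add: A_def B_def)
  have "A * B = 1\<^sub>m e"
  proof (rule eq_matI)
    fix i j assume "i < dim_row (1\<^sub>m e :: 'k mat)" "j < dim_col (1\<^sub>m e :: 'k mat)"
    then have ij: "i < e" "j < e" by auto
    have "(A * B) $$ (i, j) = (\<Sum>s\<in>{0..<e}. if s < card G then X i (h s) * Y (h s) j else 0)"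
      using ij by (simp add: A_def B_def scalar_prod_def if_distrib cong: if_cong)
    also have "\<dots> = (\<Sum>s\<in>{0..<card G}. X i (h s) * Y (h s) j)"
      using lt by (intro sum.mono_neutral_cong_right) auto
    also have "\<dots> = (\<Sum>g\<in>G. X i g * Y g j)"
      by (rule sum.reindex_bij_betw[OF h])
    finally show "(A * B) $$ (i, j) = 1\<^sub>m e $$ (i, j)" using eq ij by simp
  qed (auto simp: A_def B_def)
  then have "det A * det B = 1" using det_mult[OF AB] by simp
  moreover have "det A = 0"
  proof -
    have "A $$ (i, e - 1) = 0" if "i < e" for i
      using lt that by (auto simp: A_def)
    then show ?thesis
      using laplace_expansion_column[OF AB(1), of "e - 1"] lt by simp
  qed
  ultimately show False by simp
qed

text \<open>By isolation, an element of the ideal has no term dividing \<open>x\<^sub>i ^ c i\<close> properly, so the coefficient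
  of \<open>x\<^sub>i ^ c i\<close> in \<open>q * p\<close> only involves the constant term of \<open>q\<close>.\<close>

lemma lookup_mult_toric_ideal:
  assumes p: "p \<in> toric_ideal e n" and q: "q \<in> carrier (mpoly_ring e)" and i: "i < e"
    and iso: "\<And>x m. x < c \<Longrightarrow> Poly_Mapping.keys m \<subseteq> {..<e} \<Longrightarrow> wdeg n m = x * n i \<Longrightarrow> m = Poly_Mapping.single i x"
  shows "Poly_Mapping.lookup (q * p) (Poly_Mapping.single i c) =
    Poly_Mapping.lookup q 0 * Poly_Mapping.lookup p (Poly_Mapping.single i c)"
proof -
  let ?m = "Poly_Mapping.single i c"
  have zero: "u = 0 \<and> w = ?m" if "u + w = ?m" "w \<in> Poly_Mapping.keys p" for u w
  proof -
    have sum: "Poly_Mapping.lookup u j + Poly_Mapping.lookup w j = (if j = i then c else 0)" for j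
      using arg_cong[OF that(1), of "\<lambda>m. Poly_Mapping.lookup m j"] by (simp add: lookup_add lookup_single when_def)
    have w: "w = Poly_Mapping.single i (Poly_Mapping.lookup w i)"
      by (rule poly_mapping_eqI) (use sum in \<open>force simp: lookup_single when_def split: if_splits\<close>)
    have "\<not> Poly_Mapping.lookup w i < c"
    proof
      assume "Poly_Mapping.lookup w i < c"
      then have "Poly_Mapping.lookup p w = 0"
        using iso[of "Poly_Mapping.lookup w i"] w
        by (intro toric_ideal_lookup_isolated[OF p]) (metis wdeg_single)
      then show False using that(2) by (simp add: in_keys_iff)
    qed
    then have c: "Poly_Mapping.lookup w i = c" using sum[of i] by simp
    then have "w = ?m" using w by simp
    then show ?thesis using that(1) by simp
  qed
  have "Poly_Mapping.lookup (q * p) ?m = (\<Sum>u\<in>Poly_Mapping.keys q. \<Sum>w\<in>Poly_Mapping.keys p.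
      (Poly_Mapping.lookup q u * Poly_Mapping.lookup p w when u + w = ?m))"
    by (subst times_eq_sum_singles) (simp add: lookup_sum lookup_single)
  also have "\<dots> = (\<Sum>u\<in>Poly_Mapping.keys q. \<Sum>w\<in>Poly_Mapping.keys p.
      (if w = ?m then (if u = 0 then Poly_Mapping.lookup q u * Poly_Mapping.lookup p w else 0) else 0))"
    by (intro sum.cong refl) (use zero in \<open>auto simp: when_def\<close>)
  also have "\<dots> = (\<Sum>u\<in>Poly_Mapping.keys q. if u = 0 then Poly_Mapping.lookup q u * Poly_Mapping.lookup p ?m else 0)"
    by (intro sum.cong refl) (simp add: in_keys_iff)
  also have "\<dots> = Poly_Mapping.lookup q 0 * Poly_Mapping.lookup p ?m"
    by (simp add: in_keys_iff)
  finally show ?thesis .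
qed

text \<open>A Nakayama-type argument. Reading off the coefficients at the \<open>x_i ^ c i\<close>
  maps the ideal to k^e so that multiplication by q acts as multiplication by its constant term. The
  image is therefore spanned by the images of any generating set, while the \<open>f j\<close> map
  to the standard basis.\<close>

lemma minimal_generators_toric_ideal:
  fixes f :: "nat \<Rightarrow> 'k::field mpoly"
  assumes gen: "toric_ideal e n = Idl\<^bsub>mpoly_ring e\<^esub> (f ` {..<e})"
    and f: "\<And>j. j < e \<Longrightarrow> f j \<in> toric_ideal e n"
    and lookup: "\<And>i j. i < e \<Longrightarrow> j < e \<Longrightarrow>
      Poly_Mapping.lookup (f j) (Poly_Mapping.single i (c i)) = (if i = j then 1 else 0)"
    and iso: "\<And>i x m. i < e \<Longrightarrow> x < c i \<Longrightarrow> Poly_Mapping.keys m \<subseteq> {..<e} \<Longrightarrow>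
      wdeg n m = x * n i \<Longrightarrow> m = Poly_Mapping.single i x"
  shows "minimally_generated_by (mpoly_ring e) (toric_ideal e n :: 'k mpoly set) e"
  unfolding minimally_generated_by_def
proof (intro conjI allI impI)
  have "inj_on f {..<e}"
    by (rule inj_onI) (metis lessThan_iff lookup zero_neq_one)
  moreover have "f ` {..<e} \<subseteq> carrier (mpoly_ring e)"
    using f by (auto simp: toric_ideal_def)
  ultimately show "\<exists>G\<subseteq>carrier (mpoly_ring e). finite G \<and> card G = e \<and> Idl\<^bsub>mpoly_ring e\<^esub> G = (toric_ideal e n :: 'k mpoly set)"
    using gen by (intro exI[of _ "f ` {..<e}"]) (auto simp: card_image)
next
  fix G :: "'k mpoly set"
  assume G: "G \<subseteq> carrier (mpoly_ring e) \<and> finite G \<and> Idl\<^bsub>mpoly_ring e\<^esub> G = toric_ideal e n"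
  let ?\<phi> = "\<lambda>(p :: 'k mpoly) i. Poly_Mapping.lookup p (Poly_Mapping.single i (c i))"
  \<comment> \<open>The elements whose coefficient vector lies in the span of those of
    \<open>G\<close>. This is an ideal containing \<open>G\<close>, hence the whole toric
    ideal.\<close>
  define K where "K = {p \<in> toric_ideal e n :: 'k mpoly set. \<exists>h :: 'k mpoly \<Rightarrow> 'k. \<forall>i<e. ?\<phi> p i = (\<Sum>g\<in>G. h g * ?\<phi> g i)}"
  have K_I: "p \<in> K" if "p \<in> toric_ideal e n" "\<forall>i<e. ?\<phi> p i = (\<Sum>g\<in>G. h g * ?\<phi> g i)"
    for p and h :: "'k mpoly \<Rightarrow> 'k"
    unfolding K_def using that by blast
  have I: "ideal (toric_ideal e n :: 'k mpoly set) (mpoly_ring e)" by (rule ideal_toric_ideal)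
  note I = ideal_mpoly_ringD[OF I]
  have "ideal K (mpoly_ring e)"
  proof (rule ideal_mpoly_ringI)
    show "K \<subseteq> carrier (mpoly_ring e)" using I(5) by (auto simp: K_def)
    have "\<forall>i<e. ?\<phi> 0 i = (\<Sum>g\<in>G. 0 * ?\<phi> g i)" by simp
    with I(1) show "0 \<in> K" by (rule K_I)
    show "p + q \<in> K" if pq: "p \<in> K" "q \<in> K" for p q
    proof -
      obtain h h' where "\<forall>i<e. ?\<phi> p i = (\<Sum>g\<in>G. h g * ?\<phi> g i)" "\<forall>i<e. ?\<phi> q i = (\<Sum>g\<in>G. h' g * ?\<phi> g i)"
        using pq by (auto simp: K_def)
      then have "\<forall>i<e. ?\<phi> (p + q) i = (\<Sum>g\<in>G. (h g + h' g) * ?\<phi> g i)"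
        by (simp add: lookup_add distrib_right sum.distrib)
      moreover have "p + q \<in> toric_ideal e n"
        by (rule I(2)) (use pq in \<open>auto simp: K_def\<close>)
      ultimately show ?thesis by (rule K_I[rotated])
    qed
    show "p * q \<in> K" if pq: "p \<in> carrier (mpoly_ring e)" "q \<in> K" for p q
    proof -
      obtain h where h: "\<forall>i<e. ?\<phi> q i = (\<Sum>g\<in>G. h g * ?\<phi> g i)" and q: "q \<in> toric_ideal e n"
        using pq by (auto simp: K_def)
      have "\<forall>i<e. ?\<phi> (p * q) i = Poly_Mapping.lookup p 0 * ?\<phi> q i"
        using lookup_mult_toric_ideal[OF q pq(1)] iso by blast
      then have "\<forall>i<e. ?\<phi> (p * q) i = (\<Sum>g\<in>G. (Poly_Mapping.lookup p 0 * h g) * ?\<phi> g i)"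
        using h by (simp add: sum_distrib_left mult.assoc)
      then show ?thesis by (rule K_I[OF I(3)[OF pq(1) q]])
    qed
  qed
  moreover have "G \<subseteq> K"
  proof
    fix g assume g: "g \<in> G"
    have "\<forall>i<e. ?\<phi> g i = (\<Sum>g'\<in>G. (if g' = g then 1 else 0) * ?\<phi> g' i)"
      using g G by (simp add: if_distrib[of "\<lambda>x. x * _"] cong: if_cong)
    moreover have "g \<in> toric_ideal e n" using Idl_mpoly_ring(2)[of G e] G g by blast
    ultimately show "g \<in> K" by (rule K_I[rotated])
  qed
  ultimately have "toric_ideal e n \<subseteq> K" using Idl_mpoly_ring_minimal[of K e G] G by blast
  then have "\<forall>j. j < e \<longrightarrow> (\<exists>h. \<forall>i<e. ?\<phi> (f j) i = (\<Sum>g\<in>G. h g * ?\<phi> g i))"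
    using f unfolding K_def by blast
  then obtain H where H: "\<And>j i. j < e \<Longrightarrow> i < e \<Longrightarrow> ?\<phi> (f j) i = (\<Sum>g\<in>G. H j g * ?\<phi> g i)"
    by metis
  show "e \<le> card G"
  proof (rule card_le_of_factorization[where X = H and Y = "?\<phi>"])
    show "(\<Sum>g\<in>G. H i g * ?\<phi> g j) = (if i = j then 1 else 0)" if "i < e" "j < e" for i j
      using H[OF that] lookup[OF that(2,1)] by auto
  qed (use G in blast)
qed

section \<open>The semigroup of the cyclic matrix\<close>

lemma submonoid_gen_image:
  assumes "finite A"
  shows "submonoid_gen (f ` A) = range (\<lambda>m. \<Sum>i\<in>A. m i * f i)" (is "_ = ?R")
proof
  have "add_submonoid ?R"
    unfolding add_submonoid_def
  proof (intro conjI ballI)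
    show "0 \<in> ?R" by (rule range_eqI[of _ _ "\<lambda>_. 0"]) simp
    fix x y assume "x \<in> ?R" "y \<in> ?R"
    then obtain m m' where "x = (\<Sum>i\<in>A. m i * f i)" "y = (\<Sum>i\<in>A. m' i * f i)" by auto
    then show "x + y \<in> ?R"
      by (intro range_eqI[of _ _ "\<lambda>i. m i + m' i"]) (simp add: distrib_right sum.distrib)
  qed
  moreover have "f ` A \<subseteq> ?R"
  proof
    fix x assume "x \<in> f ` A"
    then obtain i where i: "i \<in> A" "x = f i" by blast
    show "x \<in> ?R"
      using i assms by (intro range_eqI[of _ _ "\<lambda>j. if j = i then 1 else 0"])
        (simp add: if_distrib[of "\<lambda>x. x * _"] cong: if_cong)
  qed
  ultimately show "submonoid_gen (f ` A) \<subseteq> ?R"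
    unfolding submonoid_gen_def by (intro hull_minimal)
next
  show "?R \<subseteq> submonoid_gen (f ` A)"
  proof
    fix x assume "x \<in> ?R"
    then obtain m where x: "x = (\<Sum>i\<in>A. m i * f i)" by blast
    have "x \<in> T" if T: "add_submonoid T" "f ` A \<subseteq> T" for T
    proof -
      have scale: "c * y \<in> T" if "y \<in> T" for c y
        using T(1) that by (induction c) (auto simp: add_submonoid_def)
      have "(\<Sum>i\<in>B. m i * f i) \<in> T" if "B \<subseteq> A" for B
        using finite_subset[OF that assms] that
      proof (induction B rule: finite_induct)
        case empty
        show ?case using T(1) by (simp add: add_submonoid_def)
      next
        case (insert i B)
        then have "m i * f i \<in> T" "(\<Sum>i\<in>B. m i * f i) \<in> T" using T(2) scale by auto
        then show ?case using insert.hyps T(1) by (simp add: add_submonoid_def)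
      qed
      then show ?thesis unfolding x by blast
    qed
    then show "x \<in> submonoid_gen (f ` A)" by (auto simp: submonoid_gen_def hull_def)
  qed
qed

lemma mvar_power: "mvar i ^ x = Poly_Mapping.single (Poly_Mapping.single i x) 1"
  by (induction x) (auto simp: mvar_def mult_single simp flip: single_add)

lemma prod_mvar_power:
  "(\<Prod>i\<in>A. mvar i ^ x i) = Poly_Mapping.single (\<Sum>i\<in>A. Poly_Mapping.single i (x i)) 1"
  by (induction A rule: infinite_finite_induct) (auto simp: mvar_power mult_single)

section \<open>Halving the indices modulo \<open>e\<close>\<close>

locale cyclic_data =
  fixes e' e :: nat and a :: "nat list"
  assumes e_eq: "e = 2 * e' + 1" and e'_pos: "e' > 0" and length_a: "length a = e"
    and a_pos: "\<And>i. i < e \<Longrightarrow> a ! i > 0" and a_neq: "a \<noteq> [1, 1, 1]"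
begin

text \<open>The index \<open>k\<close> of the cyclic system corresponds to \<open>p k\<close> in the theorem; \<open>q\<close> is the inverse of \<open>p\<close>.\<close>

definition p :: "nat \<Rightarrow> nat" where
  "p k = ((e' + 1) * k) mod e"

definition q :: "nat \<Rightarrow> nat" where
  "q i = (2 * i) mod e"

definition b :: "nat \<Rightarrow> nat" where
  "b k = a ! p k"

lemma e_pos: "e > 0"
  by (simp add: e_eq)

lemma p_less [simp]: "p k < e" and q_less [simp]: "q i < e"
  using e_pos by (simp_all add: p_def q_def)

lemma q_p: "q (p k) = k mod e"
proof -
  have "q (p k) = (2 * ((e' + 1) * k)) mod e" by (simp add: p_def q_def mod_mult_right_eq)
  also have "2 * ((e' + 1) * k) = k + e * k" by (simp add: e_eq algebra_simps)
  finally show ?thesis by simp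
qed

lemma p_q: "p (q i) = i mod e"
proof -
  have "p (q i) = ((e' + 1) * (2 * i)) mod e"
    unfolding p_def q_def by (rule mod_mult_right_eq)
  also have "(e' + 1) * (2 * i) = i + e * i" by (simp add: e_eq algebra_simps)
  finally show ?thesis by simp
qed

lemma p_mod [simp]: "p (k mod e) = p k"
  unfolding p_def by (rule mod_mult_right_eq)

lemma bij_p: "bij_betw p {..<e} {..<e}"
  by (rule bij_betw_byWitness[of _ q]) (auto simp: p_q q_p)

sublocale sys: cyclic_system e' e b
proof
  show "b (k + e) = b k" for k
    using p_mod[of "k + e"] p_mod[of k] by (simp add: b_def)
  show "\<exists>k<e. b k \<noteq> 1" if "e' = 1"
  proof (rule ccontr)
    assume "\<not> (\<exists>k<e. b k \<noteq> 1)"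
    then have "a ! i = 1" if "i < e" for i
      using that p_q[of i] by (metis b_def mod_less q_less)
    moreover have "e = 3" using \<open>e' = 1\<close> e_eq by simp
    ultimately have "a ! 0 = 1" "a ! 1 = 1" "a ! 2 = 1" by simp_all
    moreover obtain x y z where "a = [x, y, z]"
      using length_a \<open>e = 3\<close> by (auto simp: numeral_3_eq_3 length_Suc_conv)
    ultimately have "a = [1, 1, 1]" by simp
    then show False using a_neq by simp
  qed
  show "b k > 0" for k
    unfolding b_def by (rule a_pos) simp
qed (fact e_eq e'_pos)+

definition v :: "nat \<Rightarrow> nat" where
  "v k = nat (sys.w k)"

lemma int_v [simp]: "int (v k) = sys.w k"
  using sys.w_pos[of k] by (simp add: v_def)

definition n :: "nat \<Rightarrow> nat" where
  "n i = v (q i)"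

lemma v_mod: "v (k mod e) = v k"
  by (simp add: v_def sys.mod_e)

lemma n_p: "n (p k) = v k"
  by (simp add: n_def q_p v_mod)

definition d :: nat where
  "d = nat sys.d"

lemma int_d [simp]: "int d = sys.d"
  using sys.d_pos by (simp add: d_def)

sublocale rel: cyclic_relations e' e b v "nat sys.D" d
proof
  show "b k > 0" for k by (rule sys.b_pos)
  show "v k > 0" for k using sys.w_pos by (simp add: v_def)
  show "b (k + e) = b k" for k by (rule sys.b_per)
  show "v (k + e) = v k" for k by (simp add: v_def sys.w_per)
  show "(b k + 1) * v k + v (k + 1) = nat sys.D" for k
  proof -
    have "int ((b k + 1) * v k + v (k + 1)) = int (nat sys.D)"
      using sys.w_rel[of k] sys.D_pos by (simp add: distrib_right)
    then show ?thesis by (simp only: of_nat_eq_iff)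
  qed
  show "v 0 = 1 + (\<Sum>j<e'. b (2 * j + 1) * (\<Prod>k\<in>{2 * j + 2..<e}. b k + 1))"
  proof -
    have "int (v 0) = int (1 + (\<Sum>j<e'. b (2 * j + 1) * (\<Prod>k\<in>{2 * j + 2..<e}. b k + 1)))"
      by (simp add: sys.w_eq add.commute)
    then show ?thesis by (simp only: of_nat_eq_iff)
  qed
  show "d + (\<Sum>k<e. v k) = e' * nat sys.D"
  proof -
    have "int (d + (\<Sum>k<e. v k)) = int (e' * nat sys.D)"
      using sys.d_sum sys.D_pos by simp
    then show ?thesis by (simp only: of_nat_eq_iff)
  qed
  show "d > 0" using sys.d_pos by (simp add: d_def)
qed (auto simp: e_eq e'_pos)

abbreviation M :: "int mat" where
  "M \<equiv> cyc_mat e' a"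

lemma M_carrier: "M \<in> carrier_mat e e"
  by (simp add: cyc_mat_def Let_def e_eq)

lemma M_entry:
  "i < e \<Longrightarrow> j < e \<Longrightarrow> M $$ (i, j) = (if i = j then -1
    else if 0 < (int j - int i) mod int e \<and> (int j - int i) mod int e \<le> int e' then 0 else int (a ! j))"
  by (simp add: cyc_mat_def Let_def e_eq)

text \<open>Since 2 (e' + 1) = e + 1, halving sends the distance 2 s to s and 2 s + 1 to s + e' + 1.
  The condition that a cyclic distance lie in 1, ..., e' thus becomes a condition on parity and
  order; in each case the remainder is certified by an explicit quotient.\<close>

lemma M_p:
  assumes "k < e" "l < e"
  shows "M $$ (p k, p l) = sys_mat e b $$ (k, l)"
proof -
  have eq_iff: "p k = p l \<longleftrightarrow> k = l"
    using assms bij_p by (auto simp: bij_betw_def inj_on_def)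
  define r where "r = (int (p l) - int (p k)) mod int e"
  have r: "r = (int (e' + 1) * (int l - int k)) mod int e"
    unfolding r_def p_def of_nat_mod mod_diff_eq by (simp only: of_nat_mult right_diff_distrib)
  have M: "M $$ (p k, p l) = (if k = l then -1 else if 0 < r \<and> r \<le> int e' then 0 else int (b l))"
    using M_entry[OF p_less[of k] p_less[of l]] eq_iff by (simp add: r_def b_def)
  have val: "r = s" if "int (e' + 1) * (int l - int k) = s + int e * t" "0 \<le> s" "s < int e" for s t
    unfolding r that(1) using that(2,3) by simp
  consider "k = l" | s where "l = k + 2 * s" "s > 0" | s where "l = k + 2 * s + 1"
    | s where "k = l + 2 * s" "s > 0" | s where "k = l + 2 * s + 1"
  proof -
    have "k = l \<or> (\<exists>s>0. l = k + 2 * s) \<or> (\<exists>s. l = k + 2 * s + 1) \<or> (\<exists>s>0. k = l + 2 * s) \<or> (\<exists>s. k = l + 2 * s + 1)"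
      by presburger
    then show ?thesis using that by blast
  qed
  then show ?thesis
  proof cases
    case 1
    then show ?thesis unfolding M using assms by (simp add: sys_mat_def)
  next
    case (2 s)
    then have "r = int s"
      by (intro val[of _ "int s"]) (use assms e_eq in \<open>auto simp: algebra_simps\<close>)
    then show ?thesis unfolding M using 2 assms e_eq by (simp add: sys_mat_def)
  next
    case (3 s)
    then have "r = int s + int e' + 1"
      by (intro val[of _ "int s"]) (use assms e_eq in \<open>auto simp: algebra_simps\<close>)
    then show ?thesis unfolding M using 3 assms e_eq by (simp add: sys_mat_def)
  next
    case (4 s)
    then have "r = int e - int s"
      by (intro val[of _ "- int s - 1"]) (use assms e_eq in \<open>auto simp: algebra_simps\<close>)
    then show ?thesis unfolding M using 4 assms e_eq by (simp add: sys_mat_def)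
  next
    case (5 s)
    then have "r = int e' - int s"
      by (intro val[of _ "- int s - 1"]) (use assms e_eq in \<open>auto simp: algebra_simps\<close>)
    then show ?thesis unfolding M using 5 assms e_eq by (simp add: sys_mat_def)
  qed
qed

lemma det_M: "det M = int d"
proof -
  \<comment> \<open>\<open>p\<close> reduces modulo \<open>e\<close>, whereas
    \<open>permutes\<close> requires the identity outside \<open>{0..<e}\<close>.\<close>
  define P where "P k = (if k < e then p k else k)" for k
  have "bij_betw P {..<e} {..<e}"
    using bij_p by (subst bij_betw_cong[of _ P p]) (auto simp: P_def)
  then have "P permutes {0..<e}"
    by (intro bij_imp_permutes) (auto simp: P_def atLeast0LessThan)
  then have "det M = det (mat e e (\<lambda>(i, j). M $$ (P i, P j)))"
    by (rule det_permute_both[OF M_carrier, symmetric])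
  also have "mat e e (\<lambda>(i, j). M $$ (P i, P j)) = sys_mat e b"
    by (rule eq_matI) (auto simp: P_def M_p sys_mat_def[of e])
  finally show ?thesis by (simp add: sys.d_def)
qed

lemma sum_reindex_p: "(\<Sum>i<e. f i) = (\<Sum>k<e. f (p k))"
  by (rule sum.reindex_bij_betw[OF bij_p, symmetric])

lemma M_row_sum:
  assumes "i < e"
  shows "(\<Sum>j<e. M $$ (i, j) * int (n j)) = int d"
proof -
  have "(\<Sum>j<e. M $$ (i, j) * int (n j)) = (\<Sum>l<e. M $$ (p (q i), p l) * int (n (p l)))"
    using assms by (subst sum_reindex_p) (simp add: p_q)
  also have "\<dots> = (\<Sum>l<e. sys_mat e b $$ (q i, l) * sys.w l)"
    by (intro sum.cong) (auto simp: M_p n_p)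
  finally show ?thesis using sys.sys_mat_w[of "q i"] by simp
qed

text \<open>\<open>M_row_sum\<close> says M n = det M * 1 and the determinant is nonzero, so
  applying the inverse recovers the natural numbers \<open>n i\<close>.\<close>

lemma det_inv_one_M:
  assumes "i < e"
  shows "det_inv_one M $ i = rat_of_nat (n i)"
proof -
  let ?Q = "map_mat rat_of_int M"
  have Q: "?Q \<in> carrier_mat e e" using M_carrier by simp
  have "det ?Q = rat_of_int (det M)" by simp
  also have "\<dots> \<noteq> 0" using rel.d_pos by (simp add: det_M del: int_d)
  finally have "?Q \<in> Units (ring_mat TYPE(rat) e ())"
    by (rule det_non_zero_imp_unit[OF Q])
  then obtain B where B: "mat_inverse ?Q = Some B"
    using mat_inverse(1)[OF Q, of "()"] by fastforce
  from mat_inverse(2)[OF Q B] have BQ: "B * ?Q = 1\<^sub>m e" and Bc: "B \<in> carrier_mat e e" by auto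
  let ?n = "vec e (\<lambda>i. rat_of_nat (n i))"
  let ?one = "vec e (\<lambda>_. 1 :: rat)"
  have Qn: "?Q *\<^sub>v ?n = rat_of_int (det M) \<cdot>\<^sub>v ?one"
  proof (rule eq_vecI)
    fix i assume "i < dim_vec (rat_of_int (det M) \<cdot>\<^sub>v ?one)"
    then have i: "i < e" by simp
    have "(?Q *\<^sub>v ?n) $ i = rat_of_int (\<Sum>j<e. M $$ (i, j) * int (n j))"
      using i M_carrier by (simp add: scalar_prod_def atLeast0LessThan)
    then show "(?Q *\<^sub>v ?n) $ i = (rat_of_int (det M) \<cdot>\<^sub>v ?one) $ i"
      using i by (simp add: M_row_sum det_M)
  qed (use Q in simp)
  have "det_inv_one M = rat_of_int (det M) \<cdot>\<^sub>v (B *\<^sub>v ?one)"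
    unfolding det_inv_one_def using B M_carrier by simp
  also have "\<dots> = B *\<^sub>v (rat_of_int (det M) \<cdot>\<^sub>v ?one)"
    using Bc by (simp add: mult_mat_vec)
  also have "\<dots> = B * ?Q *\<^sub>v ?n"
    unfolding Qn[symmetric] by (rule assoc_mult_mat_vec[symmetric, OF Bc Q]) simp
  also have "\<dots> = ?n" by (simp add: BQ)
  finally show ?thesis using assms by simp
qed

lemma M_diag: "i < e \<Longrightarrow> M $$ (i, i) = -1"
  by (simp add: cyc_mat_def Let_def e_eq)

lemma M_offdiag_nonneg: "i < e \<Longrightarrow> j < e \<Longrightarrow> i \<noteq> j \<Longrightarrow> M $$ (i, j) \<ge> 0"
  by (simp add: cyc_mat_def Let_def e_eq)

lemma image_n: "n ` {..<e} = v ` {..<e}"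
proof -
  have "n ` {..<e} = n ` p ` {..<e}" using bij_p by (simp add: bij_betw_def)
  also have "\<dots> = v ` {..<e}" by (simp add: image_image n_p)
  finally show ?thesis .
qed

lemma submonoid_gen_n: "submonoid_gen (n ` {..<e}) = rel.H"
  unfolding image_n rel.H_def rel.deg_def by (rule submonoid_gen_image) simp

text \<open>Row k of the matrix, with its diagonal entry -1 moved to the other side, is a
  representation of d + v_k by nonnegative coefficients.\<close>

lemma d_plus_v: "k < e \<Longrightarrow> d + v k \<in> rel.H"
proof -
  assume k: "k < e"
  let ?S = "sys_mat e b"
  let ?m = "\<lambda>l. if l = k then 0 else nat (?S $$ (k, l))"
  have "int (rel.deg ?m) = (\<Sum>l<e. int (?m l) * sys.w l)"
    unfolding rel.deg_def by simp
  also have "\<dots> = (\<Sum>l<e. if l = k then 0 else ?S $$ (k, l) * sys.w l)"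
    using k by (intro sum.cong) (auto simp: sys_mat_def)
  also have "\<dots> = (\<Sum>l<e. ?S $$ (k, l) * sys.w l + (if l = k then sys.w k else 0))"
    using k by (intro sum.cong) (auto simp: sys_mat_def)
  also have "\<dots> = int (d + v k)"
    using k sys.sys_mat_w[OF k] by (simp add: sum.distrib)
  finally have "rel.deg ?m = d + v k" by (simp only: of_nat_eq_iff)
  then show ?thesis unfolding rel.H_def by (metis rangeI)
qed


lemma sum_reindex_fun: "(\<Sum>k<e. f (p k) * v k) = (\<Sum>i<e. f i * n i)"
  by (simp add: sum_reindex_p[of "\<lambda>i. f i * n i"] n_p)

end

section \<open>Minimal generators, gaps and symmetry of the semigroup\<close>

locale coprime_cyclic_data = cyclic_data +
  assumes gcd_n: "Gcd (n ` {..<e}) = 1"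
begin

sublocale rel: coprime_cyclic_relations e' e b v "nat sys.D" d
  by unfold_locales (use gcd_n in \<open>simp add: image_n\<close>)

abbreviation H :: "nat set" where
  "H \<equiv> rel.H"

lemma add_submonoid_H: "add_submonoid H"
  by (simp add: add_submonoid_def rel.H_0 rel.H_add)

text \<open>As \<open>b k \<ge> 1\<close>, isolation applies to the first power: \<open>y_k\<close>
  is the only monomial of degree v_k, and it does not factor.\<close>

lemma v_atom:
  assumes "x \<in> H" "y \<in> H" "x + y = v k" "k < e"
  shows "x = 0 \<or> y = 0"
proof -
  obtain m m' where m: "x = rel.deg m" "y = rel.deg m'"
    using assms by (auto simp: rel.H_def)
  have "rel.deg (m \<boxplus> m') = 1 * v k" using m assms(3) by simp
  then have *: "m i + m' i = pt k 1 i" if "i < e" for i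
    using rel.deg_eq_pure_power[of "m \<boxplus> m'" 1 k i] rel.b_pos[of k] assms(4) that
    by (simp add: madd_apply)
  have zero: "rel.deg u = 0" if "u k = 0" "\<And>i. i < e \<Longrightarrow> u i \<le> pt k 1 i" for u
    unfolding rel.deg_def
  proof (intro sum.neutral ballI)
    fix i assume "i \<in> {..<e}"
    then show "u i * v i = 0" using that(1) that(2)[of i] by (auto simp: pt_def split: if_splits)
  qed
  have "m k + m' k = 1" using *[OF assms(4)] by (simp add: pt_def)
  then have "m k = 0 \<or> m' k = 0" by linarith
  moreover have "m i \<le> pt k 1 i" "m' i \<le> pt k 1 i" if "i < e" for i
    using *[OF that] by simp_all
  ultimately show ?thesis using zero[of m] zero[of m'] m by auto
qed

text \<open>Removing an atom from \<open>H\<close> leaves a submonoid, so the other elements cannot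
  generate it.\<close>

lemma generating_set_contains_v:
  assumes "submonoid_gen A = H" "k < e"
  shows "v k \<in> A"
proof (rule ccontr)
  assume nA: "v k \<notin> A"
  have "add_submonoid (H - {v k})"
    unfolding add_submonoid_def
  proof (intro conjI ballI)
    show "0 \<in> H - {v k}" using rel.H_0 rel.v_pos[of k] by simp
    show "x + y \<in> H - {v k}" if "x \<in> H - {v k}" "y \<in> H - {v k}" for x y
      using that v_atom[of x y k] assms(2) rel.H_add[of x y] by auto
  qed
  moreover have "A \<subseteq> H" using assms(1) hull_subset[of A add_submonoid] by (simp add: submonoid_gen_def)
  ultimately have "submonoid_gen A \<subseteq> H - {v k}"
    unfolding submonoid_gen_def using nA by (intro hull_minimal) auto
  then show False using assms rel.H_v by blast
qed

lemma min_gens_H: "min_gens H = v ` {..<e}"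
  unfolding min_gens_def
proof (rule the_equality)
  have gen: "submonoid_gen (v ` {..<e}) = H" using submonoid_gen_n by (simp add: image_n)
  show "minimal_generating_set H (v ` {..<e})"
    unfolding minimal_generating_set_def using gen generating_set_contains_v by blast
  show "A = v ` {..<e}" if "minimal_generating_set H A" for A
  proof -
    have A: "submonoid_gen A = H" "\<And>B. B \<subset> A \<Longrightarrow> submonoid_gen B \<noteq> H"
      using that by (auto simp: minimal_generating_set_def)
    have "v ` {..<e} \<subseteq> A" using generating_set_contains_v[OF A(1)] by auto
    then show ?thesis using A(2)[of "v ` {..<e}"] gen by auto
  qed
qed

lemma inj_v: "inj_on v {..<e}"
proof (rule inj_onI)
  fix k l assume kl: "k \<in> {..<e}" "l \<in> {..<e}" "v k = v l"
  then have "rel.deg (pt l 1) = 1 * v k" by simp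
  then have "pt l 1 l = pt k 1 l"
    by (rule rel.deg_eq_pure_power[of "pt l 1" 1 k l]) (use kl rel.b_pos[of k] in auto)
  then show "k = l" by (simp add: pt_def split: if_splits)
qed

lemma embedding_dimension_H: "embedding_dimension H = e"
  unfolding embedding_dimension_def min_gens_H by (simp add: card_image inj_v)

text \<open>The threshold is the largest Apery element: above it, each number exceeds the Apery
  element of its residue class by a multiple of v_0.\<close>

lemma eventually_in_H: "\<exists>N. \<forall>x\<ge>N. x \<in> H"
proof (intro exI allI impI)
  fix x assume x: "x \<ge> Max (rel.deg ` rel.nf)"
  obtain m where m: "rel.deg m mod v 0 = x mod v 0" using rel.residue_attained[of x] by blast
  obtain \<mu> t where \<mu>: "\<mu> \<in> rel.nf" "rel.eqv m (\<mu> \<boxplus> pt 0 t)" using rel.nf_reduction[of m] by blast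
  have "rel.deg m = rel.deg \<mu> + t * v 0" using rel.eqv_deg[OF \<mu>(2)] e_pos by simp
  then have "rel.deg \<mu> mod v 0 = x mod v 0" using m by (metis mod_mult_self1)
  moreover have le: "rel.deg \<mu> \<le> x"
  proof -
    have "rel.deg \<mu> \<le> Max (rel.deg ` rel.nf)"
      by (rule Max_ge) (use \<mu>(1) rel.finite_nf in auto)
    then show ?thesis using x by simp
  qed
  ultimately have "v 0 dvd x - rel.deg \<mu>" using mod_eq_dvd_iff_nat[of "rel.deg \<mu>" x "v 0"] by metis
  then obtain s where "x - rel.deg \<mu> = v 0 * s" by (rule dvdE)
  then have "x = rel.deg (\<mu> \<boxplus> pt 0 s)" using le e_pos by (simp add: mult.commute)
  then show "x \<in> H" unfolding rel.H_def by blast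
qed

lemma numerical_semigroup_H: "numerical_semigroup H"
proof -
  obtain N where "\<forall>x\<ge>N. x \<in> H" using eventually_in_H by blast
  then have "- H \<subseteq> {..<N}" using not_le by blast
  then have "finite (- H)" by (rule finite_subset) simp
  then show ?thesis by (simp add: numerical_semigroup_def add_submonoid_H)
qed

lemma int_mem_H: "int x \<in> int ` H \<longleftrightarrow> x \<in> H"
  by auto

lemma pseudo_frobenius_H: "pseudo_frobenius H = {int d, 2 * int d}"
proof
  show "pseudo_frobenius H \<subseteq> {int d, 2 * int d}"
  proof
    fix f assume "f \<in> pseudo_frobenius H"
    then have "f \<notin> int ` H" "\<And>k. k < e \<Longrightarrow> f + int (v k) \<in> int ` H"
      by (auto simp: pseudo_frobenius_def min_gens_H simp del: int_v)
    from rel.pseudo_frobenius_cases[OF this] show "f \<in> {int d, 2 * int d}" by blast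
  qed
  have "int x \<in> pseudo_frobenius H" if "x \<notin> H" "\<And>k. k < e \<Longrightarrow> x + v k \<in> H" for x
    unfolding pseudo_frobenius_def min_gens_H
    using that by (auto simp: int_mem_H simp flip: of_nat_add simp del: int_v)
  from this[of d] this[of "2 * d"]
  show "{int d, 2 * int d} \<subseteq> pseudo_frobenius H"
    using rel.d_notin_H rel.two_d_notin_H d_plus_v rel.two_d_plus_v by simp
qed

lemma frobenius_number_H: "frobenius_number H = 2 * int d"
  unfolding frobenius_number_def
proof (rule Greatest_equality)
  show "2 * int d \<notin> int ` H"
    using rel.two_d_notin_H int_mem_H[of "2 * d"] by simp
  fix f assume f: "f \<notin> int ` H"
  show "f \<le> 2 * int d"
  proof (rule ccontr)
    assume "\<not> f \<le> 2 * int d"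
    \<comment> \<open>The largest gap beyond 2 d would itself be a pseudo-Frobenius number, hence d
      or 2 d. The lower bound in \<open>S\<close> cuts off the infinitely many negative gaps, so
      that a maximum exists.\<close>
    define S where "S = {g. g \<notin> int ` H \<and> 2 * int d < g}"
    obtain N where N: "\<forall>x\<ge>N. x \<in> H" using eventually_in_H by blast
    have "S \<subseteq> {2 * int d..int N}"
    proof
      fix g assume g: "g \<in> S"
      then have "g = int (nat g)" by (simp add: S_def del: int_d)
      then have "\<not> nat g \<ge> N" using g N unfolding S_def by blast
      then show "g \<in> {2 * int d..int N}" using g by (auto simp: S_def)
    qed
    then have fin: "finite S" by (rule finite_subset) simp
    have "f \<in> S" using f \<open>\<not> f \<le> 2 * int d\<close> by (simp add: S_def)
    then have max: "Max S \<in> S" using fin by (intro Max_in) auto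
    have "Max S + int (v k) \<in> int ` H" if "k < e" for k
    proof (rule ccontr)
      assume "Max S + int (v k) \<notin> int ` H"
      then have "Max S + int (v k) \<in> S" using max by (auto simp: S_def simp del: int_v int_d)
      then have "Max S + int (v k) \<le> Max S" by (rule Max_ge[OF fin])
      then show False using rel.v_pos[of k] by (simp del: int_v)
    qed
    then have "Max S = int d \<or> Max S = 2 * int d"
      using max by (intro rel.pseudo_frobenius_cases) (auto simp: S_def)
    then show False using max rel.d_pos by (auto simp: S_def simp del: int_d)
  qed
qed

lemma pseudo_symmetric_H: "pseudo_symmetric H"
  unfolding pseudo_symmetric_def frobenius_number_H pseudo_frobenius_H
  by (auto simp: numerical_semigroup_H)

lemma rf_matrix_M: "rf_matrix e n (int d) M"
  unfolding rf_matrix_def submonoid_gen_n pseudo_frobenius_H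
  using M_carrier M_diag M_offdiag_nonneg M_row_sum by blast

section \<open>Critical exponents and critical binomials\<close>

definition tail :: "nat \<Rightarrow> nat \<Rightarrow> nat" where
  "tail k = pt ((k + 1) mod e) (b (k + 1)) \<boxplus> pt ((k + 2) mod e) 1"

lemma deg_tail: "rel.deg (tail k) = (b k + 1) * v k"
  using rel.critical_rel[of k] e_pos by (simp add: tail_def v_mod)

lemma tail_self: "k < e \<Longrightarrow> tail k k = 0"
  using rel.e_ge3 by (auto simp: tail_def madd_apply pt_def mod_Suc split: if_splits)

text \<open>The tail of the critical relation represents (b_k + 1) v_k without \<open>y_k\<close>.
  For smaller x > 0, isolation leaves \<open>y_k ^ x\<close> as the only monomial of degree x v_k,
  so the remaining generators do not reach it.\<close>

lemma crit_exp_n: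
  assumes i: "i < e"
  shows "crit_exp e n i = a ! i + 1"
proof -
  define k where "k = q i"
  have k: "k < e" "p k = i" using i by (simp_all add: k_def p_q)
  have bk: "b k = a ! i" using k by (simp add: b_def)
  have nk: "n i = v k" using k n_p by metis
  have gen: "submonoid_gen (n ` ({..<e} - {i})) = range (\<lambda>m. \<Sum>j\<in>{..<e} - {i}. m j * n j)"
    by (rule submonoid_gen_image) simp
  have deg: "rel.deg (\<lambda>l. if l = k then 0 else m (p l)) = (\<Sum>j\<in>{..<e} - {i}. m j * n j)" for m
  proof -
    have "(\<Sum>j\<in>{..<e} - {i}. m j * n j) = (\<Sum>j<e. (if j = i then 0 else m j) * n j)"
      by (intro sum.mono_neutral_cong_left) auto
    also have "\<dots> = (\<Sum>l<e. (if p l = i then 0 else m (p l)) * v l)"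
      by (rule sum_reindex_fun[symmetric])
    also have "\<dots> = rel.deg (\<lambda>l. if l = k then 0 else m (p l))"
      unfolding rel.deg_def using k bij_p
      by (intro sum.cong) (auto simp: bij_betw_def inj_on_def)
    finally show ?thesis by simp
  qed
  show ?thesis
    unfolding crit_exp_def
  proof (rule Least_equality)
    have "(\<Sum>j\<in>{..<e} - {i}. tail k (q j) * n j) = rel.deg (\<lambda>l. if l = k then 0 else tail k (q (p l)))"
      by (rule deg[symmetric])
    also have "\<dots> = rel.deg (tail k)"
      using tail_self[OF k(1)] by (intro rel.deg_cong) (auto simp: q_p)
    also have "\<dots> = (b k + 1) * v k" by (rule deg_tail)
    finally have sum: "(\<Sum>j\<in>{..<e} - {i}. tail k (q j) * n j) = (b k + 1) * v k" .
    show "a ! i + 1 > 0 \<and> (a ! i + 1) * n i \<in> submonoid_gen (n ` ({..<e} - {i}))"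
      unfolding gen nk bk[symmetric]
      by (intro conjI range_eqI[of _ _ "\<lambda>j. tail k (q j)"] sum[symmetric]) simp
  next
    fix x assume x: "x > 0 \<and> x * n i \<in> submonoid_gen (n ` ({..<e} - {i}))"
    then obtain m where m: "x * v k = (\<Sum>j\<in>{..<e} - {i}. m j * n j)"
      unfolding gen nk by auto
    show "a ! i + 1 \<le> x"
    proof (rule ccontr)
      assume "\<not> a ! i + 1 \<le> x"
      then have "x \<le> b k" by (simp add: bk)
      then have "(if k = k then 0 else m (p k)) = pt k x k"
        using m k by (intro rel.deg_eq_pure_power[of "\<lambda>l. if l = k then 0 else m (p l)"]) (simp_all add: deg)
      then show False using x by (simp add: pt_def)
    qed
  qed
qed

lemma wdeg_eq_deg:
  assumes "Poly_Mapping.keys m \<subseteq> {..<e}"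
  shows "wdeg n m = rel.deg (\<lambda>k. Poly_Mapping.lookup m (p k))"
  unfolding rel.deg_def sum_reindex_fun by (rule wdeg_superset) (use assms in auto)

lemma isolated:
  assumes "i < e" "x < a ! i + 1" "Poly_Mapping.keys m \<subseteq> {..<e}" "wdeg n m = x * n i"
  shows "m = Poly_Mapping.single i x"
proof (rule poly_mapping_eqI)
  fix j
  show "Poly_Mapping.lookup m j = Poly_Mapping.lookup (Poly_Mapping.single i x) j"
  proof (cases "j < e")
    case True
    have *: "Poly_Mapping.lookup m (p (q j)) = pt (q i) x (q j)"
    proof (rule rel.deg_eq_pure_power)
      show "rel.deg (\<lambda>k. Poly_Mapping.lookup m (p k)) = x * v (q i)"
        using assms(4) wdeg_eq_deg[OF assms(3)] by (simp add: n_def)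
      show "x \<le> b (q i)" using assms(1,2) by (simp add: b_def p_q)
    qed simp_all
    have "q i = q j \<longleftrightarrow> i = j" using assms(1) True p_q by (metis mod_less)
    then show ?thesis using * True by (auto simp: p_q pt_def lookup_single when_def)
  next
    case False
    then have "j \<notin> Poly_Mapping.keys m" using assms(3) by auto
    then show ?thesis using False assms(1) by (auto simp: in_keys_iff lookup_single when_def)
  qed
qed

text \<open>Passes from the cyclic indexing \<open>y_k = x_(p k)\<close> to ring monomials; values
  of \<open>m\<close> at indices from \<open>e\<close> on are discarded.\<close>

definition emon :: "(nat \<Rightarrow> nat) \<Rightarrow> nat \<Rightarrow>\<^sub>0 nat" where
  "emon m = (\<Sum>i<e. Poly_Mapping.single i (m (q i)))"

lemma lookup_emon: "Poly_Mapping.lookup (emon m) i = (if i < e then m (q i) else 0)"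
  by (simp add: emon_def lookup_sum lookup_single when_def)

lemma keys_emon: "Poly_Mapping.keys (emon m) \<subseteq> {..<e}"
  by (auto simp: in_keys_iff lookup_emon split: if_splits)

lemma emon_lookup:
  "Poly_Mapping.keys m \<subseteq> {..<e} \<Longrightarrow> emon (\<lambda>k. Poly_Mapping.lookup m (p k)) = m"
  by (rule poly_mapping_eqI) (auto simp: lookup_emon p_q in_keys_iff subset_iff)

lemma emon_add: "emon (m \<boxplus> m') = emon m + emon m'"
  by (rule poly_mapping_eqI) (simp add: lookup_emon lookup_add madd_apply)

lemma wdeg_emon: "wdeg n (emon m) = rel.deg m"
  unfolding wdeg_eq_deg[OF keys_emon] by (rule rel.deg_cong) (simp add: lookup_emon q_p)

lemma emon_pt: "k < e \<Longrightarrow> emon (pt k x) = Poly_Mapping.single (p k) x"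
proof (rule poly_mapping_eqI)
  fix i assume "k < e"
  then have "i < e \<Longrightarrow> q i = k \<longleftrightarrow> p k = i"
    using p_q[of i] q_p[of k] by auto
  moreover have "p k < e" by simp
  ultimately show "Poly_Mapping.lookup (emon (pt k x)) i = Poly_Mapping.lookup (Poly_Mapping.single (p k) x) i"
    by (auto simp: lookup_emon pt_def lookup_single when_def)
qed

text \<open>Ensures that a pure power enters a critical binomial only through its leading term, so
  that the coefficient matrix in \<open>lookup_crit\<close> is the identity.\<close>

lemma emon_tail_neq: "emon (tail k) \<noteq> Poly_Mapping.single i c"
proof
  assume eq: "emon (tail k) = Poly_Mapping.single i c"
  have "Poly_Mapping.lookup (emon (tail k)) (p (k + 1)) > 0" "Poly_Mapping.lookup (emon (tail k)) (p (k + 2)) > 0"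
    using rel.b_pos[of "k + 1"] by (simp_all add: lookup_emon q_p tail_def madd_apply pt_def)
  then have "p (k + 1) = i" "p (k + 2) = i" unfolding eq by (auto simp: lookup_single when_def split: if_splits)
  then have "q (p (k + 1)) = q (p (k + 2))" by simp
  then have "(k + 1) mod e = Suc (k + 1) mod e" by (simp add: q_p)
  moreover have "r \<noteq> (if Suc r = e then 0 else Suc r)" for r
    using rel.e_ge3 by auto
  ultimately show False unfolding mod_Suc[of "k + 1" e] by blast
qed

definition crit :: "nat \<Rightarrow> 'k::field mpoly" where
  "crit i = mvar i ^ (a ! i + 1) - Poly_Mapping.single (emon (tail (q i))) 1"

lemma crit_eq: "i < e \<Longrightarrow> crit i = Poly_Mapping.single (emon (pt (q i) (b (q i) + 1))) 1 - Poly_Mapping.single (emon (tail (q i))) 1"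
  unfolding crit_def mvar_power by (simp add: emon_pt p_q b_def)

lemma single_emon_carrier: "Poly_Mapping.single (emon m) c \<in> carrier (mpoly_ring e)"
  by (rule single_mem_carrier[OF keys_emon])

lemma crit_mem_toric_ideal: "i < e \<Longrightarrow> crit i \<in> toric_ideal e n"
  by (simp add: toric_ideal_def crit_eq carrier_mpoly_ring_diff single_emon_carrier toric_map_minus
      wdeg_emon deg_tail)

lemma lookup_crit:
  "i < e \<Longrightarrow> j < e \<Longrightarrow> Poly_Mapping.lookup (crit j) (Poly_Mapping.single i (a ! i + 1)) = (if i = j then 1 else 0)"
proof -
  have "Poly_Mapping.single j (a ! j + 1) = Poly_Mapping.single i (a ! i + 1) \<longleftrightarrow> i = j"
  proof
    assume "Poly_Mapping.single j (a ! j + 1) = Poly_Mapping.single i (a ! i + 1)"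
    from arg_cong[OF this, of Poly_Mapping.keys] show "i = j" by simp
  qed simp
  then show ?thesis
    unfolding crit_def mvar_power lookup_minus lookup_single when_def
    by (simp only: emon_tail_neq if_False diff_0_right)
qed

lemma critical_binomial_crit:
  assumes i: "i < e"
  shows "critical_binomial e n i (crit i :: 'k::field mpoly)"
proof -
  have "(\<Prod>j\<in>{..<e} - {i}. mvar j ^ tail (q i) (q j) :: 'k mpoly) = (\<Prod>j<e. mvar j ^ tail (q i) (q j))"
    using tail_self[of "q i"] by (intro prod.mono_neutral_left) auto
  also have "\<dots> = Poly_Mapping.single (emon (tail (q i))) 1"
    unfolding prod_mvar_power emon_def ..
  finally show ?thesis
    unfolding critical_binomial_def crit_exp_n[OF i]
    using crit_mem_toric_ideal[OF i]
    by (auto simp: crit_def intro!: exI[of _ "\<lambda>j. tail (q i) (q j)"])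
qed

text \<open>Chains of moves become telescoping sums of binomials, and a single move is a monomial
  multiple of one critical binomial.\<close>

lemma eqv_diff_mem:
  fixes J :: "'k::field mpoly set"
  assumes J: "ideal J (mpoly_ring e)" and crit: "\<And>i. i < e \<Longrightarrow> crit i \<in> J"
    and "rel.eqv m m'"
  shows "Poly_Mapping.single (emon m) 1 - Poly_Mapping.single (emon m') 1 \<in> J"
  using assms(3)
proof induction
  case (eqv_ext m m')
  then have "emon m = emon m'" by (simp add: emon_def)
  then show ?case using ideal_mpoly_ringD(1)[OF J] by simp
next
  case (eqv_sym m m')
  then show ?case using ideal_mpoly_ringD(4)[OF J] by fastforce
next
  case (eqv_trans m m' m'')
  then show ?case using ideal_mpoly_ringD(2)[OF J eqv_trans.IH] by simp
next
  case (eqv_move k m)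
  have "(crit (p k) :: 'k mpoly) \<in> J" by (rule crit) simp
  then have "Poly_Mapping.single (emon m) 1 * (crit (p k) :: 'k mpoly) \<in> J"
    by (rule ideal_mpoly_ringD(3)[OF J single_emon_carrier])
  then show ?case
    using eqv_move by (simp add: crit_eq q_p right_diff_distrib mult_single emon_add tail_def)
qed

lemma toric_ideal_eq_Idl: "(toric_ideal e n :: 'k::field mpoly set) = Idl\<^bsub>mpoly_ring e\<^esub> (crit ` {..<e})"
proof
  let ?G = "crit ` {..<e} :: 'k mpoly set"
  have G: "?G \<subseteq> toric_ideal e n" using crit_mem_toric_ideal by auto
  then have Gc: "?G \<subseteq> carrier (mpoly_ring e)" by (auto simp: toric_ideal_def)
  show "Idl\<^bsub>mpoly_ring e\<^esub> ?G \<subseteq> toric_ideal e n"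
    by (rule Idl_mpoly_ring_minimal[OF ideal_toric_ideal G])
  show "toric_ideal e n \<subseteq> Idl\<^bsub>mpoly_ring e\<^esub> ?G"
  proof (rule toric_ideal_subset[OF Idl_mpoly_ring(1)[OF Gc]])
    fix m m' assume m: "Poly_Mapping.keys m \<subseteq> {..<e}" "Poly_Mapping.keys m' \<subseteq> {..<e}" "wdeg n m = wdeg n m'"
    then have "rel.eqv (\<lambda>k. Poly_Mapping.lookup m (p k)) (\<lambda>k. Poly_Mapping.lookup m' (p k))"
      by (simp add: rel.eqv_iff_deg_eq wdeg_eq_deg)
    from eqv_diff_mem[OF Idl_mpoly_ring(1)[OF Gc] _ this]
    show "Poly_Mapping.single m 1 - Poly_Mapping.single m' 1 \<in> Idl\<^bsub>mpoly_ring e\<^esub> ?G"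
      using Idl_mpoly_ring(2)[OF Gc] m by (simp add: emon_lookup image_subset_iff)
  qed
qed

lemma toric_ideal_critical_n: "toric_ideal_critical TYPE('k::field) e n"
  unfolding toric_ideal_critical_def
proof (rule exI[of _ "crit :: nat \<Rightarrow> 'k mpoly"], rule conjI)
  show "\<forall>i<e. critical_binomial e n i (crit i :: 'k mpoly)"
    by (intro allI impI critical_binomial_crit)
  show "toric_ideal e n = Idl\<^bsub>mpoly_ring e\<^esub> ((crit :: nat \<Rightarrow> 'k mpoly) ` {..<e})"
    by (rule toric_ideal_eq_Idl)
qed

lemma toric_ideal_almost_ci_n: "toric_ideal_almost_ci TYPE('k::field) e n"
  unfolding toric_ideal_almost_ci_def
proof (rule minimal_generators_toric_ideal[where f = crit and c = "\<lambda>i. a ! i + 1"])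
  show "toric_ideal e n = Idl\<^bsub>mpoly_ring e\<^esub> ((crit :: nat \<Rightarrow> 'k mpoly) ` {..<e})"
    by (rule toric_ideal_eq_Idl)
  show "crit j \<in> toric_ideal e n" if "j < e" for j
    by (rule crit_mem_toric_ideal[OF that])
  show "Poly_Mapping.lookup (crit j :: 'k mpoly) (Poly_Mapping.single i (a ! i + 1)) = (if i = j then 1 else 0)"
    if "i < e" "j < e" for i j
    by (rule lookup_crit[OF that])
  show "m = Poly_Mapping.single i x"
    if "i < e" "x < a ! i + 1" "Poly_Mapping.keys m \<subseteq> {..<e}" "wdeg n m = x * n i" for i x m
    by (rule isolated[OF that])
qed

end

theorem theorem7p1:
  fixes e e' :: nat and a :: "nat list" and M :: "int mat"
  assumes "e = 2 * e' + 1" and "e \<ge> 3"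
    and "length a = e" and "\<forall>i<e. a ! i > 0" and "a \<noteq> [1, 1, 1]"
    and "M = cyc_mat e' a"
  shows "det M > 0 \<and>
    (\<exists>n :: nat \<Rightarrow> nat.
       (\<forall>i<e. det_inv_one M $ i = rat_of_nat (n i)) \<and>
       (\<forall>i<e. n i > 0) \<and>
       (Gcd (n ` {..<e}) = 1 \<longrightarrow>
          (let H = submonoid_gen (n ` {..<e}) in
            embedding_dimension H = e \<and>
            pseudo_symmetric H \<and>
            pseudo_frobenius H = {det M, 2 * det M} \<and>
            toric_ideal_critical TYPE('k::field) e n \<and>
            toric_ideal_almost_ci TYPE('k) e n \<and>
            (\<forall>i<e. crit_exp e n i = a ! i + 1) \<and>
            rf_matrix e n (det M) M)))"
proof -
  interpret D: cyclic_data e' e a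
  proof
    show "e' > 0" using assms(1,2) by simp
    show "a ! i > 0" if "i < e" for i using assms(4) that by blast
  qed (fact assms(1,3,5))+
  have M: "M = D.M" by (rule assms(6))
  show ?thesis
  proof (intro conjI exI[of _ D.n] allI impI)
    show "det M > 0" unfolding M D.det_M using D.rel.d_pos by (simp del: D.int_d)
    show "det_inv_one M $ i = rat_of_nat (D.n i)" if "i < e" for i
      unfolding M by (rule D.det_inv_one_M[OF that])
    show "D.n i > 0" for i
      unfolding D.n_def by (rule D.rel.v_pos)
    assume gcd: "Gcd (D.n ` {..<e}) = 1"
    interpret C: coprime_cyclic_data e' e a
      by unfold_locales (rule gcd)
    show "let H = submonoid_gen (D.n ` {..<e}) in
            embedding_dimension H = e \<and>
            pseudo_symmetric H \<and>
            pseudo_frobenius H = {det M, 2 * det M} \<and>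
            toric_ideal_critical TYPE('k::field) e D.n \<and>
            toric_ideal_almost_ci TYPE('k) e D.n \<and>
            (\<forall>i<e. crit_exp e D.n i = a ! i + 1) \<and>
            rf_matrix e D.n (det M) M"
      unfolding Let_def D.submonoid_gen_n M D.det_M
      by (intro conjI allI impI C.embedding_dimension_H C.pseudo_symmetric_H C.pseudo_frobenius_H
          C.toric_ideal_critical_n C.toric_ideal_almost_ci_n C.crit_exp_n C.rf_matrix_M)
  qed
qed

end
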